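(* Let $d\ge1$, $T>0$, $\alpha>0$, $\beta>1$, $q\ge1$, and let $g:(0,\infty)\to\mathbb{R}$ be smooth and non-decreasing. Let $u,m\in C^\infty(\mathbb{T}^d\times[0,T])$ with $m>0$ (both periodic in $x$) solve the first-order mean-field game with congestion $$\begin{cases}-u_t+m^{\alpha(1-\beta)}\dfrac{|Du|^\beta}{\beta}=g(m),\\[2mm] m_t-\operatorname{div}\big(m^{1+\alpha(1-\beta)}\,Du\,|Du|^{\beta-2}\big)=0,\end{cases}\qquad(x,t)\in\mathbb{T}^d\times(0,T).$$ Assume that $q+2\alpha(1-\beta)>0$ and that either $$\beta\ge2\quad\text{and}\quad 1-\frac{1-\frac1d}{q+2\alpha(1-\beta)}-\frac{\alpha(\beta-1)}{2}\ge0,$$ or $$1<\beta<2\quad\text{and}\quad 1-\frac{1-\frac1d}{q+2\alpha(1-\beta)}-\frac{\alpha}{2}\ge0.$$ Then the function $$t\mapsto\int_{\mathbb{T}^d}m(x,t)^q\,dx$$ is convex on $[0,T]$.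
   Context: $\mathbb{T}^d=\mathbb{R}^d/\mathbb{Z}^d$ is the $d$-dimensional flat torus (of Lebesgue measure $1$); functions on $\mathbb{T}^d$ are identified with $\mathbb{Z}^d$-periodic functions on $\mathbb{R}^d$. $D$ and $\operatorname{div}$ denote the gradient and divergence in the space variable $x$; the subscript $t$ denotes the time derivative. The vector field $Du|Du|^{\beta-2}$ is the gradient of $p\mapsto|p|^\beta/\beta$ evaluated at $p=Du$, so it equals $0$ where $Du=0$. *)

theory Defs
  imports "HOL-Analysis.Analysis"
begin

text \<open>
  Continuous differentiability of order \<open>k\<close> on a set \<open>S\<close>, with derivatives taken within \<open>S\<close>.
  It is meant for convex \<open>S\<close> with nonempty interior, where these derivatives are unique. On a
  closed \<open>S\<close>, such as \<open>UNIV \<times> {0..T}\<close> with \<open>T > 0\<close>, it expresses regularity up to the boundary.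
\<close>

primrec C_k_on :: "nat \<Rightarrow> 'a::euclidean_space set \<Rightarrow> ('a \<Rightarrow> real) \<Rightarrow> bool" where
  "C_k_on 0 S f \<longleftrightarrow> continuous_on S f"
| "C_k_on (Suc k) S f \<longleftrightarrow>
     (\<exists>f'. (\<forall>x\<in>S. (f has_derivative f' x) (at x within S)) \<and> (\<forall>v. C_k_on k S (\<lambda>x. f' x v)))"

definition smooth_on :: "'a::euclidean_space set \<Rightarrow> ('a \<Rightarrow> real) \<Rightarrow> bool" where
  "smooth_on S f \<longleftrightarrow> (\<forall>k. C_k_on k S f)"

definition torus_periodic :: "(real^'n \<Rightarrow> 'b) \<Rightarrow> bool" where
  "torus_periodic f \<longleftrightarrow> (\<forall>x z. (\<forall>i. z $ i \<in> \<int>) \<longrightarrow> f (x + z) = f x)"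

text \<open>
  Functions in \<open>C\<^sup>\<infinity>(T\<^sup>d \<times> [0,T])\<close>, as functions on \<open>\<real>\<^sup>d\<close> and time. Values at times outside
  \<open>[0,T]\<close> are irrelevant.
\<close>

definition smooth_torus_time :: "real \<Rightarrow> (real^'n \<Rightarrow> real \<Rightarrow> real) \<Rightarrow> bool" where
  "smooth_torus_time T f \<longleftrightarrow>
     (\<forall>t\<in>{0..T}. torus_periodic (\<lambda>x. f x t)) \<and>
     smooth_on (UNIV \<times> {0..T}) (\<lambda>(x, t). f x t)"

text \<open>The integral over the torus of a periodic function is its integral over the unit cube.\<close>

definition torus_integral :: "(real^'n \<Rightarrow> real) \<Rightarrow> real" where
  "torus_integral f = integral (cbox 0 One) f"

definition gradient :: "(real^'n \<Rightarrow> real) \<Rightarrow> real^'n \<Rightarrow> real^'n" where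
  "gradient f x = (THE D. GDERIV f x :> D)"

text \<open>
  The divergence is a relation: the flux of the congestion system is not smooth where the gradient
  vanishes if \<open>\<beta> < 2\<close>, so the existence of its partial derivatives is part of what solving the
  system means.
\<close>

definition has_divergence :: "(real^'n \<Rightarrow> real^'n) \<Rightarrow> real \<Rightarrow> real^'n \<Rightarrow> bool" where
  "has_divergence F D x \<longleftrightarrow>
     (\<exists>F'. (\<forall>i. ((\<lambda>s. F (x + s *\<^sub>R axis i 1) $ i) has_real_derivative F' i) (at 0)) \<and>
           D = (\<Sum>i\<in>UNIV. F' i))"

text \<open>
  At a zero of the gradient both \<open>norm _ powr \<beta>\<close> and the flux are \<open>0\<close>, for every \<open>\<beta> > 1\<close>,
  because \<open>0 powr a = 0\<close>.
\<close>

definition solves_congestion_mfg ::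
  "real \<Rightarrow> real \<Rightarrow> real \<Rightarrow> (real \<Rightarrow> real) \<Rightarrow> (real^'n \<Rightarrow> real \<Rightarrow> real) \<Rightarrow> (real^'n \<Rightarrow> real \<Rightarrow> real) \<Rightarrow> bool"
where
  "solves_congestion_mfg T \<alpha> \<beta> g u m \<longleftrightarrow>
     (\<forall>x. \<forall>t\<in>{0<..<T}.
        - deriv (u x) t
          + m x t powr (\<alpha> * (1 - \<beta>)) * (norm (gradient (\<lambda>y. u y t) x) powr \<beta> / \<beta>)
          = g (m x t) \<and>
        has_divergence
          (\<lambda>y. (m y t powr (1 + \<alpha> * (1 - \<beta>)) * norm (gradient (\<lambda>z. u z t) y) powr (\<beta> - 2))
                 *\<^sub>R gradient (\<lambda>z. u z t) y)
          (deriv (m x) t) x)"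

end

theory Submission
  imports Defs
begin

text \<open>
  Write \<open>p = Du\<close>, \<open>V = p |p|\<^bsup>\<beta>-2\<^esup>\<close>, \<open>\<gamma> = \<alpha> (1 - \<beta>)\<close>, \<open>r = q + 2 \<gamma>\<close>. Formally the derivative of
  \<open>\<integral> m\<^sup>q\<close> is \<open>q (q - 1) I\<close> with \<open>I = - \<integral> m\<^bsup>q+\<gamma>-1\<^esup> Dm \<sqdot> V\<close>, and \<open>I'\<close> is the integral of a
  quadratic form in \<open>div V\<close> and \<open>Dm \<sqdot> V\<close>, nonnegative by \<open>tr ((DV)\<^sup>2) \<ge> (div V)\<^sup>2 / d\<close> as soon as
  \<open>1 - (1 - 1/d) / r \<ge> \<alpha> \<beta> / 4\<close>; this is weaker than both alternatives of the hypothesis.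

  As \<open>V\<close> need not be smooth where \<open>p = 0\<close>, it is replaced by \<open>W = \<eta> V\<close> with
  \<open>\<eta> = (max 0 (1 + ln |p|\<^sup>2 / L))\<^sup>2\<close>. All terms produced by differentiating \<open>\<eta>\<close> carry the factor
  \<open>\<zeta> = |p| d\<eta>/d|p| = O(1 / L)\<close>. Since \<open>div V\<close> is bounded, by the second equation, they contribute to
  \<open>I'\<close> at least \<open>\<zeta> (c s\<^sup>2 - C)\<close>, where \<open>s = |p|\<^bsup>\<beta>-2\<^esup> (D\<^sup>2u p \<sqdot> p) / |p|\<^sup>2\<close>. Hence \<open>I\<close> is
  nondecreasing in the limit \<open>L \<rightarrow> \<infinity>\<close>. The error in the identity for the derivative of \<open>\<integral> m\<^sup>q\<close>
  is of size \<open>\<integral> \<zeta> |s|\<close>; the term \<open>c s\<^sup>2\<close> just gained bounds its time integral, so the identity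
  holds in the limit as well, because \<open>m\<^sub>t = 0\<close> almost everywhere on \<open>{p = 0}\<close>.
\<close>

subsection \<open>Directional derivatives\<close>

definition pd :: "'a::real_normed_vector \<Rightarrow> ('a \<Rightarrow> real) \<Rightarrow> 'a \<Rightarrow> real" where
  "pd v f z = frechet_derivative f (at z) v"

text \<open>Only the restriction to a line is differentiated: partial derivatives are all that the
  second equation supplies for its flux, which need not be differentiable where Du = 0.\<close>

definition has_pd :: "('a::real_normed_vector \<Rightarrow> real) \<Rightarrow> 'a \<Rightarrow> real \<Rightarrow> 'a \<Rightarrow> bool" where
  "has_pd f v d z \<longleftrightarrow> ((\<lambda>s. f (z + s *\<^sub>R v)) has_real_derivative d) (at 0)"

lemma has_pd_unique: "has_pd f v d z \<Longrightarrow> has_pd f v d' z \<Longrightarrow> d = d'"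
  unfolding has_pd_def by (rule DERIV_unique)

lemma has_pd_eq: "has_pd f v d z \<Longrightarrow> d = d' \<Longrightarrow> has_pd f v d' z"
  by simp

lemma has_pd_const: "has_pd (\<lambda>z. c) v 0 z"
  unfolding has_pd_def by (auto intro!: derivative_eq_intros)

lemma has_pd_minus: "has_pd f v d z \<Longrightarrow> has_pd (\<lambda>z. - f z) v (- d) z"
  unfolding has_pd_def by (auto intro!: derivative_eq_intros)

lemma has_pd_diff: "has_pd f v d z \<Longrightarrow> has_pd g v e z \<Longrightarrow> has_pd (\<lambda>z. f z - g z) v (d - e) z"
  unfolding has_pd_def by (auto intro!: derivative_eq_intros)

lemma has_pd_mult:
  "has_pd f v d z \<Longrightarrow> has_pd g v e z \<Longrightarrow> has_pd (\<lambda>z. f z * g z) v (d * g z + f z * e) z"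
  unfolding has_pd_def by (auto intro!: derivative_eq_intros)

lemma has_pd_sum:
  "(\<And>i. i \<in> I \<Longrightarrow> has_pd (f i) v (d i) z) \<Longrightarrow>
   has_pd (\<lambda>z. \<Sum>i\<in>I. f i z) v (\<Sum>i\<in>I. d i) z"
  unfolding has_pd_def by (auto intro!: derivative_eq_intros)

lemma has_pd_compose:
  "(h has_real_derivative h') (at (f z)) \<Longrightarrow> has_pd f v d z \<Longrightarrow>
   has_pd (\<lambda>z. h (f z)) v (h' * d) z"
  unfolding has_pd_def
  by (rule DERIV_chain2[where g = "\<lambda>s. f (z + s *\<^sub>R v)"]) auto

lemma has_pd_powr:
  assumes "has_pd f v d z" "f z > 0"
  shows "has_pd (\<lambda>z. f z powr e) v (e * f z powr (e - 1) * d) z"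
proof (rule has_pd_compose[OF _ assms(1)])
  show "((\<lambda>x. x powr e) has_real_derivative e * f z powr (e - 1)) (at (f z))"
    using assms(2) by (rule has_real_derivative_powr)
qed

lemma has_pd_cong_open:
  assumes "open S" "z \<in> S" "\<And>y. y \<in> S \<Longrightarrow> f y = g y" "has_pd f v d z"
  shows "has_pd g v d z"
proof -
  have "((\<lambda>s. z + s *\<^sub>R v) \<longlongrightarrow> z + 0 *\<^sub>R v) (at 0)"
    by (intro tendsto_intros)
  then have "\<forall>\<^sub>F s in at 0. z + s *\<^sub>R v \<in> S"
    using topological_tendstoD[of _ z "at 0" S] assms(1,2) by auto
  then have "\<forall>\<^sub>F s in nhds 0. z + s *\<^sub>R v \<in> S"
    using assms(2) by (simp add: eventually_nhds_conv_at)
  then have ev: "\<forall>\<^sub>F s in nhds 0. f (z + s *\<^sub>R v) = g (z + s *\<^sub>R v)"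
    by (rule eventually_mono) (use assms(3) in auto)
  show ?thesis
    using assms(4) DERIV_cong_ev[OF refl ev refl] unfolding has_pd_def by blast
qed

lemma has_derivative_has_pd:
  assumes "(f has_derivative F) (at z)"
  shows "has_pd f v (F v) z"
proof -
  have "((\<lambda>s. z + s *\<^sub>R v) has_derivative (\<lambda>s. s *\<^sub>R v)) (at 0)"
    by (auto intro!: derivative_eq_intros)
  then have "((\<lambda>s. f (z + s *\<^sub>R v)) has_derivative (\<lambda>s. F (s *\<^sub>R v))) (at 0)"
    by (rule has_derivative_compose) (use assms in simp)
  moreover have "F (s *\<^sub>R v) = F v * s" for s
    using linear_cmul[OF has_derivative_linear[OF assms], of s v] by simp
  ultimately show ?thesis
    unfolding has_pd_def has_field_derivative_def by simp
qed

lemma has_pd_line: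
  assumes "has_pd f v d (z + s *\<^sub>R v)"
  shows "((\<lambda>s. f (z + s *\<^sub>R v)) has_real_derivative d) (at s)"
proof -
  have "((\<lambda>r. f (z + (r + s) *\<^sub>R v)) has_real_derivative d) (at 0)"
    using assms by (simp add: has_pd_def algebra_simps scaleR_add_left)
  then show ?thesis
    using DERIV_shift[of "\<lambda>s. f (z + s *\<^sub>R v)" d 0 s] by simp
qed

subsection \<open>Smooth functions on open sets\<close>

lemma C_k_on_cong:
  "C_k_on k S f \<Longrightarrow> (\<And>x. x \<in> S \<Longrightarrow> f x = g x) \<Longrightarrow> C_k_on k S g"
proof (induction k arbitrary: f g)
  case 0
  then show ?case using continuous_on_cong[of S S f g] by simp
next
  case (Suc k)
  then obtain f' where f': "\<forall>x\<in>S. (f has_derivative f' x) (at x within S)"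
    "\<forall>v. C_k_on k S (\<lambda>x. f' x v)" by auto
  have "\<forall>x\<in>S. (g has_derivative f' x) (at x within S)"
    using f'(1) Suc.prems(2) has_derivative_transform by metis
  with f'(2) show ?case by auto
qed

lemma C_k_on_subset: "C_k_on k S f \<Longrightarrow> S' \<subseteq> S \<Longrightarrow> C_k_on k S' f"
proof (induction k arbitrary: f)
  case 0
  then show ?case using continuous_on_subset by auto
next
  case (Suc k)
  then obtain f' where f': "\<forall>x\<in>S. (f has_derivative f' x) (at x within S)"
    "\<forall>v. C_k_on k S (\<lambda>x. f' x v)" by auto
  have "\<forall>x\<in>S'. (f has_derivative f' x) (at x within S')"
    using f'(1) Suc.prems(2) has_derivative_subset by blast
  with f'(2) Suc show ?case by auto
qed

lemma smooth_on_subset: "smooth_on S f \<Longrightarrow> S' \<subseteq> S \<Longrightarrow> smooth_on S' f"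
  unfolding smooth_on_def by (auto intro: C_k_on_subset)

lemma smooth_on_continuous: "smooth_on S f \<Longrightarrow> continuous_on S f"
  unfolding smooth_on_def using C_k_on.simps(1) by blast

lemma smooth_on_has_derivative:
  assumes "smooth_on S f" "open S" "z \<in> S"
  shows "(f has_derivative frechet_derivative f (at z)) (at z)"
proof -
  have "C_k_on (Suc 0) S f" using assms(1) unfolding smooth_on_def by blast
  then obtain f' where "(f has_derivative f' z) (at z within S)"
    using assms(3) by auto
  then have "(f has_derivative f' z) (at z)"
    using at_within_open[OF assms(3,2)] by argo
  then show ?thesis
    using frechet_derivative_works differentiable_def by blast
qed

lemma smooth_on_has_pd: "smooth_on S f \<Longrightarrow> open S \<Longrightarrow> z \<in> S \<Longrightarrow> has_pd f v (pd v f z) z"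
  unfolding pd_def by (intro has_derivative_has_pd smooth_on_has_derivative)

lemma smooth_on_pd:
  assumes "smooth_on S f" "open S"
  shows "smooth_on S (pd v f)"
  unfolding smooth_on_def
proof
  fix k
  have "C_k_on (Suc k) S f" using assms(1) unfolding smooth_on_def by blast
  then obtain f' where f': "\<forall>x\<in>S. (f has_derivative f' x) (at x within S)"
    "\<forall>v. C_k_on k S (\<lambda>x. f' x v)" by auto
  have "f' x v = pd v f x" if "x \<in> S" for x
  proof -
    have "(f has_derivative f' x) (at x)" using f'(1) that at_within_open[OF that assms(2)] by metis
    then show ?thesis unfolding pd_def using frechet_derivative_at by metis
  qed
  then show "C_k_on k S (pd v f)" using f'(2) C_k_on_cong by blast
qed

text \<open>The mean value theorem is applied first along \<open>v\<close> to the increment of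
  \<open>f\<close> over \<open>s *\<^sub>R w\<close>, then along \<open>w\<close> to
  \<open>fv\<close>.\<close>

lemma second_difference_mvt:
  fixes f :: "'a::real_normed_vector \<Rightarrow> real"
  assumes fv: "\<And>a b. a \<in> {0..s} \<Longrightarrow> b \<in> {0..s} \<Longrightarrow> has_pd f v (fv (z + a *\<^sub>R v + b *\<^sub>R w)) (z + a *\<^sub>R v + b *\<^sub>R w)"
    and fvw: "\<And>a b. a \<in> {0..s} \<Longrightarrow> b \<in> {0..s} \<Longrightarrow> has_pd fv w (fvw (z + a *\<^sub>R v + b *\<^sub>R w)) (z + a *\<^sub>R v + b *\<^sub>R w)"
    and s: "s > 0"
  shows "\<exists>a\<in>{0..s}. \<exists>b\<in>{0..s}.
    f (z + s *\<^sub>R v + s *\<^sub>R w) - f (z + s *\<^sub>R v) - f (z + s *\<^sub>R w) + f z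
      = s * s * fvw (z + a *\<^sub>R v + b *\<^sub>R w)"
proof -
  have d: "((\<lambda>a. f (z + a *\<^sub>R v + b *\<^sub>R w)) has_real_derivative fv (z + a *\<^sub>R v + b *\<^sub>R w)) (at a)"
    if "a \<in> {0..s}" "b \<in> {0..s}" for a b
  proof -
    have "has_pd f v (fv (z + a *\<^sub>R v + b *\<^sub>R w)) ((z + b *\<^sub>R w) + a *\<^sub>R v)"
      using fv[OF that] by (simp add: algebra_simps)
    from has_pd_line[OF this] show ?thesis by (simp add: algebra_simps)
  qed
  have "\<exists>a>0. a < s \<and> (f (z + s *\<^sub>R v + s *\<^sub>R w) - f (z + s *\<^sub>R v + 0 *\<^sub>R w)) - (f (z + 0 *\<^sub>R v + s *\<^sub>R w) - f (z + 0 *\<^sub>R v + 0 *\<^sub>R w))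
      = (s - 0) * (fv (z + a *\<^sub>R v + s *\<^sub>R w) - fv (z + a *\<^sub>R v + 0 *\<^sub>R w))"
    by (rule MVT2[OF s, of "\<lambda>a. f (z + a *\<^sub>R v + s *\<^sub>R w) - f (z + a *\<^sub>R v + 0 *\<^sub>R w)"])
      (intro DERIV_diff d; use s in auto)
  then obtain a where a: "0 < a" "a < s" and ea: "f (z + s *\<^sub>R v + s *\<^sub>R w) - f (z + s *\<^sub>R v) - f (z + s *\<^sub>R w) + f z
      = s * (fv (z + a *\<^sub>R v + s *\<^sub>R w) - fv (z + a *\<^sub>R v))" by auto
  have "\<exists>b>0. b < s \<and> fv (z + a *\<^sub>R v + s *\<^sub>R w) - fv (z + a *\<^sub>R v + 0 *\<^sub>R w) = (s - 0) * fvw (z + a *\<^sub>R v + b *\<^sub>R w)"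
    by (rule MVT2[OF s, of "\<lambda>b. fv (z + a *\<^sub>R v + b *\<^sub>R w)"])
      (rule has_pd_line, use fvw a in auto)
  then obtain b where "0 < b" "b < s" "fv (z + a *\<^sub>R v + s *\<^sub>R w) - fv (z + a *\<^sub>R v) = s * fvw (z + a *\<^sub>R v + b *\<^sub>R w)" by auto
  then show ?thesis using a ea by (intro bexI[of _ a] bexI[of _ b]) auto
qed

lemma tendsto_two_scale:
  fixes z :: "'a::real_normed_vector"
  assumes "isCont h z" and "\<And>n. a n \<in> {0..c n}" "\<And>n. b n \<in> {0..c n}" "c \<longlonglongrightarrow> 0"
  shows "(\<lambda>n. h (z + a n *\<^sub>R v + b n *\<^sub>R w)) \<longlonglongrightarrow> h z"
proof -
  have "a \<longlonglongrightarrow> (0::real)" "b \<longlonglongrightarrow> (0::real)"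
    by (rule tendsto_sandwich[OF _ _ tendsto_const assms(4)]; use assms in auto)+
  then have "(\<lambda>n. z + a n *\<^sub>R v + b n *\<^sub>R w) \<longlonglongrightarrow> z + 0 *\<^sub>R v + 0 *\<^sub>R w"
    by (intro tendsto_intros)
  then show ?thesis using isCont_tendsto_compose[OF assms(1)] by simp
qed

text \<open>Schwarz's theorem. The second difference is symmetric in \<open>v\<close> and
  \<open>w\<close>, so the two mixed derivatives agree at two points within distance O(s) of
  \<open>z\<close>; continuity carries this to \<open>z\<close>.\<close>

lemma pd_commute:
  fixes f :: "'a::euclidean_space \<Rightarrow> real"
  assumes f: "smooth_on S f" and S: "open S" and z: "z \<in> S"
  shows "pd v (pd w f) z = pd w (pd v f) z"
proof -
  have "((\<lambda>(a, b). z + a *\<^sub>R v + b *\<^sub>R w) \<longlongrightarrow> z + 0 *\<^sub>R v + 0 *\<^sub>R w) (nhds (0::real, 0::real))"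
    unfolding split_beta
    using tendsto_fst[OF filterlim_ident] tendsto_snd[OF filterlim_ident]
    by (intro tendsto_intros) force+
  then have "\<forall>\<^sub>F c in nhds (0::real, 0::real). (\<lambda>(a, b). z + a *\<^sub>R v + b *\<^sub>R w) c \<in> S"
    using S z by (auto simp: tendsto_def)
  then have "\<forall>\<^sub>F c in nhds (0::real) \<times>\<^sub>F nhds (0::real). (\<lambda>(a, b). z + a *\<^sub>R v + b *\<^sub>R w) c \<in> S"
    by (simp add: nhds_prod)
  then obtain P Q where P: "eventually P (nhds (0::real))" and Q: "eventually Q (nhds (0::real))"
    and PQ: "\<And>a b. P a \<Longrightarrow> Q b \<Longrightarrow> z + a *\<^sub>R v + b *\<^sub>R w \<in> S"
    unfolding eventually_prod_filter by auto
  from eventually_conj[OF P Q] obtain d where d: "d > 0" "\<And>a. dist a 0 < d \<Longrightarrow> P a \<and> Q a"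
    unfolding eventually_nhds_metric by blast
  have inS: "z + a *\<^sub>R v + b *\<^sub>R w \<in> S" if "a \<in> {0..s}" "b \<in> {0..s}" "s < d" for a b s
    using that d(2)[of a] d(2)[of b] PQ by auto
  have inS': "z + a *\<^sub>R w + b *\<^sub>R v \<in> S" if "a \<in> {0..s}" "b \<in> {0..s}" "s < d" for a b s
    using inS[OF that(2,1,3)] by (simp add: algebra_simps)
  \<comment> \<open>The shift by 2 keeps \<open>c n\<close> strictly below \<open>d\<close> already
    for \<open>n = 0\<close>.\<close>
  define c where "c n = d / real (n + 2)" for n
  have c: "0 < c n" "c n < d" for n
    using d(1) by (auto simp: c_def divide_less_eq)
  have clim: "c \<longlonglongrightarrow> 0"
    unfolding c_def by (rule LIMSEQ_ignore_initial_segment[OF lim_const_over_n])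
  let ?D = "\<lambda>s. f (z + s *\<^sub>R v + s *\<^sub>R w) - f (z + s *\<^sub>R v) - f (z + s *\<^sub>R w) + f z"
  have "\<exists>a\<in>{0..c n}. \<exists>b\<in>{0..c n}. ?D (c n) = c n * c n * pd w (pd v f) (z + a *\<^sub>R v + b *\<^sub>R w)" for n
    by (rule second_difference_mvt[where fv = "pd v f"])
      (use c in \<open>auto intro!: smooth_on_has_pd[OF _ S] smooth_on_pd f S inS[where s = "c n"]\<close>)
  then obtain a b where ab: "\<And>n. a n \<in> {0..c n}" "\<And>n. b n \<in> {0..c n}"
    "\<And>n. ?D (c n) = c n * c n * pd w (pd v f) (z + a n *\<^sub>R v + b n *\<^sub>R w)" by metis
  let ?E = "\<lambda>s. f (z + s *\<^sub>R w + s *\<^sub>R v) - f (z + s *\<^sub>R w) - f (z + s *\<^sub>R v) + f z"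
  have "\<exists>a\<in>{0..c n}. \<exists>b\<in>{0..c n}. ?E (c n) = c n * c n * pd v (pd w f) (z + a *\<^sub>R w + b *\<^sub>R v)" for n
    by (rule second_difference_mvt[where fv = "pd w f"])
      (use c in \<open>auto intro!: smooth_on_has_pd[OF _ S] smooth_on_pd f S inS'[where s = "c n"]\<close>)
  then obtain a' b' where ab': "\<And>n. a' n \<in> {0..c n}" "\<And>n. b' n \<in> {0..c n}"
    "\<And>n. ?E (c n) = c n * c n * pd v (pd w f) (z + a' n *\<^sub>R w + b' n *\<^sub>R v)" by metis
  have DE: "?D (c n) = ?E (c n)" for n by (simp add: algebra_simps)
  have "c n * c n * pd w (pd v f) (z + a n *\<^sub>R v + b n *\<^sub>R w)
      = c n * c n * pd v (pd w f) (z + a' n *\<^sub>R w + b' n *\<^sub>R v)" for n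
    using ab(3)[of n] ab'(3)[of n] DE[of n] by (simp only:)
  then have eq: "pd w (pd v f) (z + a n *\<^sub>R v + b n *\<^sub>R w) = pd v (pd w f) (z + a' n *\<^sub>R w + b' n *\<^sub>R v)" for n
    using c(1)[of n] by (metis mult_cancel_left mult_eq_0_iff less_irrefl)
  have cont: "isCont (pd v (pd w f)) z" "isCont (pd w (pd v f)) z"
    using smooth_on_continuous[OF smooth_on_pd[OF smooth_on_pd[OF f S] S]] S z
    by (auto simp: continuous_on_eq_continuous_at)
  show ?thesis
    using LIMSEQ_unique[OF tendsto_two_scale[OF cont(1) ab'(1,2) clim, of w v]
        tendsto_two_scale[OF cont(2) ab(1,2) clim, of v w, unfolded eq]] .
qed

subsection \<open>Integration by parts on the torus\<close>

text \<open>The shifted cube is cut at \<open>x $ i = 1\<close>, and the part beyond is moved back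
  by one period onto the slab of the unit cube below \<open>x $ i = s\<close>.\<close>

lemma torus_integral_shift:
  fixes F :: "real^'n \<Rightarrow> real"
  assumes per: "\<And>x. F (x + axis i 1) = F x" and cont: "continuous_on UNIV F"
    and s: "0 \<le> s" "s \<le> 1"
  shows "torus_integral (\<lambda>x. F (x + s *\<^sub>R axis i 1)) = torus_integral F"
proof -
  let ?e = "axis i 1 :: real^'n"
  have e: "?e \<in> Basis" by (auto simp: Basis_vec_def)
  have int: "F integrable_on cbox a b" for a b
    by (rule integrable_continuous) (use cont continuous_on_subset in blast)
  let ?m = "(\<chi> j. if j = i then s else 1) :: real^'n"
  define N where "N = (One :: real^'n)"
  have c: "N $ j = 1" "?e $ j = (if j = i then 1 else 0)" "x \<bullet> ?e = x $ i" for j x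
    unfolding inner_axis by (auto simp: N_def axis_def simp flip: Cart_1)
  have box: "cbox (s *\<^sub>R ?e) (N + s *\<^sub>R ?e) \<inter> {x. x \<bullet> ?e \<le> 1} = cbox (s *\<^sub>R ?e) N"
    "cbox (s *\<^sub>R ?e) (N + s *\<^sub>R ?e) \<inter> {x. x \<bullet> ?e \<ge> 1} = cbox (0 + ?e) (?m + ?e)"
    "cbox 0 N \<inter> {x. x \<bullet> ?e \<le> s} = cbox 0 ?m"
    "cbox 0 N \<inter> {x. x \<bullet> ?e \<ge> s} = cbox (s *\<^sub>R ?e) N"
    using s by (simp_all add: set_eq_iff mem_box_cart c) (smt (verit))+
  have "torus_integral (\<lambda>x. F (x + s *\<^sub>R ?e)) = integral (cbox 0 N) (F \<circ> ((+) (s *\<^sub>R ?e)))"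
    by (simp add: torus_integral_def o_def add.commute N_def)
  also have "\<dots> = integral (cbox (s *\<^sub>R ?e) (N + s *\<^sub>R ?e)) F"
    by (subst integral_shift_cbox_plus) simp
  also have "\<dots> = integral (cbox (s *\<^sub>R ?e) N) F + integral (cbox (0 + ?e) (?m + ?e)) F"
    using integral_split[OF int e, of "s *\<^sub>R ?e" "N + s *\<^sub>R ?e" 1] unfolding box .
  also have "integral (cbox (0 + ?e) (?m + ?e)) F = integral (cbox 0 ?m) (F \<circ> ((+) ?e))"
    by (rule integral_shift_cbox_plus[symmetric])
  also have "\<dots> = integral (cbox 0 ?m) F"
    using per by (simp add: o_def add.commute)
  finally show ?thesis
    using integral_split[OF int e, of 0 N s] unfolding box by (simp add: torus_integral_def N_def)
qed

text \<open>The integral of \<open>F\<close> translated by \<open>s\<close> along the axis does not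
  depend on \<open>s\<close>; it is differentiated under the integral sign at
  \<open>s = 0\<close>.\<close>

lemma torus_integral_pd_eq_0:
  fixes F :: "real^'n \<Rightarrow> real"
  assumes per: "\<And>x. F (x + axis i 1) = F x"
    and der: "\<And>x. has_pd F (axis i 1) (F' x) x"
    and cont: "continuous_on UNIV F" "continuous_on UNIV F'"
  shows "torus_integral F' = 0"
proof -
  let ?e = "axis i 1 :: real^'n"
  have c: "continuous_on A F" "continuous_on A F'" for A
    using cont continuous_on_subset by auto
  have "((\<lambda>s. integral (cbox 0 One) (\<lambda>x. F (x + s *\<^sub>R ?e))) has_field_derivative
      integral (cbox 0 One) (\<lambda>x. F' (x + 0 *\<^sub>R ?e))) (at 0 within {0..1})"
    by (rule leibniz_rule_field_derivative[where fx = "\<lambda>s x. F' (x + s *\<^sub>R ?e)"])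
      (auto intro!: DERIV_subset[OF has_pd_line[OF der]] integrable_continuous 
         continuous_on_compose2[OF cont(1)] continuous_on_compose2[OF cont(2)] continuous_intros
         simp: split_beta)
  then have "((\<lambda>s. integral (cbox 0 One) (\<lambda>x. F (x + s *\<^sub>R ?e))) has_field_derivative
      torus_integral F') (at 0 within {0..1})"
    by (simp add: torus_integral_def)
  then have "((\<lambda>s. torus_integral F) has_field_derivative torus_integral F') (at 0 within {0..1})"
    by (rule has_field_derivative_transform_within[OF _ zero_less_one])
      (auto simp: torus_integral_def intro!: torus_integral_shift[OF per cont(1), unfolded torus_integral_def])
  moreover have "((\<lambda>s. torus_integral F) has_field_derivative 0) (at 0 within {0..1})"
    by simp
  ultimately show ?thesis
    by (rule has_field_derivative_unique) (simp add: at_within_Icc_at_right)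
qed

subsection \<open>The logarithmic cutoff\<close>

text \<open>Here \<open>s\<close> stands for |Du|^2. The ramp vanishes for 0 < s \<le> exp (-L) and
  tends to 1 for fixed s > 0 as L grows. It is not capped at 1, since a cap would create a second
  kink.\<close>

definition log_ramp :: "real \<Rightarrow> real \<Rightarrow> real" where
  "log_ramp L s = max 0 (1 + ln s / L)"

text \<open>Multiplying by \<open>(log_ramp L s)\<^sup>2\<close> makes a power of \<open>s\<close> vanish near \<open>0\<close>, at the cost of a
  logarithmic derivative that is only \<open>O(1 / L)\<close>. The case distinction is needed because \<open>ln 0 = 0\<close>.\<close>

definition cutoff :: "real \<Rightarrow> real \<Rightarrow> real \<Rightarrow> real" where
  "cutoff L k s = (if s \<le> 0 then 0 else (log_ramp L s)\<^sup>2 * s powr k)"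

definition cutoff_deriv :: "real \<Rightarrow> real \<Rightarrow> real \<Rightarrow> real" where
  "cutoff_deriv L k s =
     (if s \<le> 0 then 0 else (2 * log_ramp L s / L + k * (log_ramp L s)\<^sup>2) * s powr (k - 1))"

lemma log_ramp_eq_0: "L > 0 \<Longrightarrow> 0 < s \<Longrightarrow> s \<le> exp (- L) \<Longrightarrow> log_ramp L s = 0"
proof -
  assume *: "L > 0" "0 < s" "s \<le> exp (- L)"
  then have "ln s \<le> - L" by (metis ln_exp ln_mono)
  then have "ln s / L \<le> - 1" using * by (simp add: divide_le_eq)
  then show ?thesis by (simp add: log_ramp_def)
qed

lemma cutoff_eq_0: "L > 0 \<Longrightarrow> s \<le> exp (- L) \<Longrightarrow> cutoff L k s = 0"
  by (simp add: cutoff_def log_ramp_eq_0)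

lemma cutoff_deriv_eq_0: "L > 0 \<Longrightarrow> s \<le> exp (- L) \<Longrightarrow> cutoff_deriv L k s = 0"
  by (simp add: cutoff_deriv_def log_ramp_eq_0)

text \<open>This is why the ramp is squared: the square of the positive part is C^1 across its
  kink.\<close>

lemma DERIV_max_0_square: "((\<lambda>y. (max 0 y)\<^sup>2) has_real_derivative 2 * max 0 y) (at y)" for y :: real
proof (cases y "0::real" rule: linorder_cases)
  case less
  have "((\<lambda>y. 0) has_real_derivative 0) (at y)" by simp
  then show ?thesis
    by (rule has_field_derivative_transform_within[of _ _ _ _ "- y", THEN DERIV_cong]) 
      (use less in \<open>auto simp: dist_real_def max_def abs_if split: if_splits\<close>)
next
  case greater
  have "((\<lambda>y. y\<^sup>2) has_real_derivative 2 * y) (at y)" by (auto intro!: derivative_eq_intros)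
  then show ?thesis
    by (rule has_field_derivative_transform_within[of _ _ _ _ y, THEN DERIV_cong]) 
      (use greater in \<open>auto simp: dist_real_def max_def abs_if split: if_splits\<close>)
next
  case equal
  have "((\<lambda>h. (max 0 h)\<^sup>2 / h) \<longlongrightarrow> max 0 (0::real)) (at 0)"
    by (rule Lim_transform_eventually[OF tendsto_max[OF tendsto_const tendsto_ident_at]])
      (auto simp: max_def power2_eq_square eventually_at intro!: exI[of _ 1])
  then show ?thesis using equal by (simp add: DERIV_def)
qed

lemma DERIV_cutoff:
  assumes L: "L > 0"
  shows "(cutoff L k has_real_derivative cutoff_deriv L k s) (at s)"
proof (cases "s > 0")
  case True
  have "((\<lambda>s. (max 0 (1 + ln s / L))\<^sup>2 * s powr k) has_real_derivative
      (2 * max 0 (1 + ln s / L) * (inverse s / L)) * s powr k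
      + (k * s powr (k - 1)) * (max 0 (1 + ln s / L))\<^sup>2) (at s)"
    using True L
    by (intro DERIV_mult has_real_derivative_powr DERIV_chain2[OF DERIV_max_0_square])
      (auto intro!: derivative_eq_intros simp: divide_inverse)
  moreover have "s powr k = s * s powr (k - 1)"
    using True by (simp add: powr_mult_base)
  ultimately have "((\<lambda>s. (max 0 (1 + ln s / L))\<^sup>2 * s powr k) has_real_derivative cutoff_deriv L k s) (at s)"
    using True L by (simp add: cutoff_deriv_def log_ramp_def field_simps)
  then show ?thesis
    by (rule has_field_derivative_transform_within[of _ _ _ _ s]) 
      (use True in \<open>auto simp: dist_real_def cutoff_def log_ramp_def\<close>)
next
  \<comment> \<open>For \<open>s \<le> 0\<close> the cutoff is zero everywhere below
    \<open>exp (- L)\<close>, hence on a neighbourhood of \<open>s\<close>, whatever the sign of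
    \<open>k\<close>.\<close>
  case False
  have "((\<lambda>y. 0) has_real_derivative 0) (at s)" by simp
  then have "(cutoff L k has_real_derivative 0) (at s)"
    by (rule has_field_derivative_transform_within[of _ _ _ _ "exp (- L)"]) 
      (use False L in \<open>auto simp: dist_real_def cutoff_eq_0\<close>)
  then show ?thesis using False by (simp add: cutoff_deriv_def)
qed

lemma continuous_on_cutoff: "L > 0 \<Longrightarrow> continuous_on A (cutoff L k)"
  by (meson DERIV_cutoff DERIV_isCont continuous_at_imp_continuous_on)

lemma continuous_on_cutoff_deriv:
  assumes L: "L > 0"
  shows "continuous_on A (cutoff_deriv L k)"
proof -
  have "continuous_on {0<..} (\<lambda>s. (2 * max 0 (1 + ln s / L) / L + k * (max 0 (1 + ln s / L))\<^sup>2) * s powr (k - 1))"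
    using L by (intro continuous_intros) auto
  then have "continuous_on {0<..} (cutoff_deriv L k)"
    by (rule continuous_on_eq) (auto simp: cutoff_deriv_def log_ramp_def)
  moreover have "continuous_on {..<exp (- L)} (cutoff_deriv L k)"
    by (rule continuous_on_eq[OF continuous_on_const[of _ 0]]) (use L in \<open>auto simp: cutoff_deriv_eq_0\<close>)
  ultimately have "continuous_on ({0<..} \<union> {..<exp (- L)}) (cutoff_deriv L k)"
    by (intro continuous_on_open_Un) auto
  moreover have "x \<in> {0<..} \<union> {..<exp (- L)}" for x
    using exp_gt_zero[of "- L"] by (cases "x > 0") (auto simp: less_le_trans simp del: exp_gt_zero)
  ultimately show ?thesis
    by (meson continuous_on_subset subsetI)
qed

lemma log_ramp_nonneg: "log_ramp L s \<ge> 0"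
  by (simp add: log_ramp_def)

lemma log_ramp_le:
  assumes "L \<ge> 1" "0 < s" "s \<le> S" "1 \<le> S"
  shows "log_ramp L s \<le> 1 + ln S"
proof -
  have "ln s \<le> ln S" "0 \<le> ln S" using assms by auto
  then have "ln s / L \<le> ln S"
    using assms(1) by (smt (verit) divide_le_eq mult_le_cancel_left1 divide_nonpos_pos)
  with \<open>0 \<le> ln S\<close> show ?thesis by (simp add: log_ramp_def)
qed

lemma cutoff_pos: "s > 0 \<Longrightarrow> cutoff L k s = (log_ramp L s)\<^sup>2 * s powr k"
  by (simp add: cutoff_def)

text \<open>The factor 2 anticipates the chain rule with \<sigma> = |Du|^2, whose gradient is 2 D^2u
  Du.\<close>

lemma cutoff_deriv_pos:
  assumes "s > 0"
  shows "2 * cutoff_deriv L k s = (4 * log_ramp L s / L + 2 * k * (log_ramp L s)\<^sup>2) * s powr k / s"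
proof -
  have "s powr (k - 1) = s powr k / s" using assms by (simp add: powr_diff)
  then show ?thesis using assms by (simp add: cutoff_deriv_def algebra_simps add_divide_distrib)
qed

lemma cutoff_tendsto:
  assumes "s > 0"
  shows "(\<lambda>n. cutoff (real (Suc n)) k s) \<longlonglongrightarrow> s powr k"
proof -
  have "(\<lambda>n. ln s / real (Suc n)) \<longlonglongrightarrow> 0"
    using LIMSEQ_ignore_initial_segment[OF lim_const_over_n[of "ln s"], of 1] by simp
  then have "(\<lambda>n. (max 0 (1 + ln s / real (Suc n)))\<^sup>2 * s powr k) \<longlonglongrightarrow> (max 0 (1 + 0))\<^sup>2 * s powr k"
    by (intro tendsto_intros)
  then show ?thesis using assms by (simp add: cutoff_def log_ramp_def)
qed

subsection \<open>Points isolated along a line\<close>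

text \<open>For every N, the translates of \<open>A\<close> by \<open>l * d / N\<close> along
  \<open>e\<close>, \<open>l < N\<close>, are disjoint and lie in one fixed ball, so N times the
  measure of \<open>A\<close> stays bounded.\<close>

lemma negligible_disjoint_translates:
  fixes A :: "'a::euclidean_space set"
  assumes A: "A \<in> lmeasurable" "bounded A"
    and disj: "\<And>x s. x \<in> A \<Longrightarrow> 0 < \<bar>s\<bar> \<Longrightarrow> \<bar>s\<bar> < d \<Longrightarrow> x + s *\<^sub>R e \<notin> A" and d: "d > 0"
  shows "negligible A"
proof -
  obtain R where R: "\<And>x. x \<in> A \<Longrightarrow> norm x \<le> R" using A(2) unfolding bounded_iff by auto
  let ?K = "cball 0 (R + d * norm e) :: 'a set"
  have N: "real N * measure lebesgue A \<le> measure lebesgue ?K" if "N > 0" for N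
  proof -
    let ?t = "\<lambda>l. (+) ((real l * d / N) *\<^sub>R e) ` A"
    have "disjoint_family_on ?t {..<N}"
    unfolding disjoint_family_on_def
    proof (intro ballI impI, rule ccontr)
      fix k l assume kl: "k \<in> {..<N}" "l \<in> {..<N}" "k \<noteq> l" "?t k \<inter> ?t l \<noteq> {}"
      then obtain x y where xy: "x \<in> A" "y \<in> A" "(real k * d / N) *\<^sub>R e + x = (real l * d / N) *\<^sub>R e + y" by auto
      have "x + ((real k - real l) * d / N) *\<^sub>R e = y"
        using xy(3) by (simp add: algebra_simps diff_divide_distrib)
      moreover have "\<bar>real k - real l\<bar> < N" using kl by auto
      then have "\<bar>(real k - real l) * d / N\<bar> < d"
        using that d by (simp add: abs_mult divide_less_eq mult.commute)
      moreover have "0 < \<bar>(real k - real l) * d / N\<bar>" using kl d that by simp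
      ultimately show False using disj xy by blast
    qed
    then have "measure lebesgue (\<Union>l<N. ?t l) = (\<Sum>l<N. measure lebesgue (?t l))"
      using fmeasurableD2[OF measurable_translation[OF A(1)]] fmeasurableD[OF measurable_translation[OF A(1)]]
      by (intro measure_finite_Union) auto
    also have "\<dots> = real N * measure lebesgue A"
      by (simp add: measure_translation)
    finally have "real N * measure lebesgue A = measure lebesgue (\<Union>l<N. ?t l)" by simp
    also have "\<dots> \<le> measure lebesgue ?K"
    proof (rule measure_mono_fmeasurable)
      show "(\<Union>l<N. ?t l) \<subseteq> ?K"
      proof clarsimp
        fix l x assume "l < N" "x \<in> A"
        have "norm ((real l * d / N) *\<^sub>R e + x) \<le> norm ((real l * d / N) *\<^sub>R e) + norm x" by (rule norm_triangle_ineq)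
        also have "norm ((real l * d / N) *\<^sub>R e) \<le> d * norm e"
        proof -
          have "real l * d / N \<le> d" using \<open>l < N\<close> d by (simp add: divide_le_eq mult.commute)
          then show ?thesis using mult_right_mono[of "real l * d / N" d "norm e"] d by simp
        qed
        also have "norm x \<le> R" using R \<open>x \<in> A\<close> by auto
        finally show "norm ((real l * d / N) *\<^sub>R e + x) \<le> R + d * norm e" by simp
      qed
      show "(\<Union>l<N. ?t l) \<in> sets lebesgue"
        using A(1) by (intro sets.finite_UN) (auto simp: measurable_translation fmeasurableD)
    qed auto
    finally show ?thesis .
  qed
  have "measure lebesgue A \<le> 0"
  proof (rule ccontr)
    assume "\<not> ?thesis"
    then obtain N :: nat where "measure lebesgue ?K < N * measure lebesgue A"
      using reals_Archimedean3[of "measure lebesgue A"] by auto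
    moreover from this have "N > 0" by (cases N) (auto simp: not_less)
    ultimately show False using N[of N] by simp
  qed
  then show ?thesis using A(1) by (simp add: negligible_iff_measure measure_le_0_iff)
qed

text \<open>Such points have disjoint short translates along \<open>e\<close>. Measurability holds
  because the set arises from \<open>Z\<close> by removing countably many closed sets, each the sum
  of \<open>Z\<close> and a compact set.\<close>

lemma negligible_isolated_along:
  fixes Z :: "'a::euclidean_space set"
  assumes Z: "closed Z" and d: "d > 0"
  shows "negligible {x \<in> Z. \<forall>s. 0 < \<bar>s\<bar> \<and> \<bar>s\<bar> < d \<longrightarrow> x + s *\<^sub>R e \<notin> Z}" (is "negligible ?E")
proof -
  \<comment> \<open>The compact sets \<open>?C k\<close> exhaust
    \<open>0 < \<bar>s\<bar> < d\<close>, and \<open>?F k\<close> consists of the points with a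
    partner in \<open>Z\<close> at a displacement from \<open>?C k\<close>.\<close>
  let ?C = "\<lambda>k::nat. {s. 1 / Suc k \<le> \<bar>s\<bar> \<and> \<bar>s\<bar> \<le> d - 1 / Suc k}"
  let ?F = "\<lambda>k. (\<Union>x\<in>Z. \<Union>y\<in>(\<lambda>s. - s *\<^sub>R e) ` ?C k. {x + y})"
  have "closed (?F k)" for k
  proof (rule closed_compact_sums[OF Z])
    have "closed (?C k)" by (intro closed_Collect_conj closed_Collect_le continuous_intros)
    moreover have "bounded (?C k)"
      unfolding bounded_iff by (intro exI[of _ d]) (auto intro: order_trans)
    ultimately show "compact ((\<lambda>s. - s *\<^sub>R e) ` ?C k)"
      by (intro compact_continuous_image continuous_intros) (simp add: compact_eq_bounded_closed)
  qed
  moreover have "?E = Z - (\<Union>k. ?F k)"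
  proof (intro set_eqI iffI)
    fix x assume x: "x \<in> ?E"
    { fix k y s assume "y \<in> Z" "s \<in> ?C k" "x = y + (- s *\<^sub>R e)"
      then have "x + s *\<^sub>R e \<in> Z" "0 < \<bar>s\<bar>" "\<bar>s\<bar> < d"
        by (auto simp: intro: less_le_trans[of _ "1 / Suc k"] le_less_trans[of _ "d - 1 / Suc k"])
      with x have False by auto }
    with x show "x \<in> Z - (\<Union>k. ?F k)" by blast
  next
    fix x assume x: "x \<in> Z - (\<Union>k. ?F k)"
    { fix s assume s: "0 < \<bar>s\<bar>" "\<bar>s\<bar> < d" "x + s *\<^sub>R e \<in> Z"
      then obtain k where "inverse (real (Suc k)) < min \<bar>s\<bar> (d - \<bar>s\<bar>)"
        using reals_Archimedean[of "min \<bar>s\<bar> (d - \<bar>s\<bar>)"] by auto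
      then have "s \<in> ?C k" by (auto simp: inverse_eq_divide)
      moreover have "x = (x + s *\<^sub>R e) + (- s *\<^sub>R e)" by simp
      ultimately have "x \<in> ?F k" using s(3) by blast
      with x have False by auto }
    with x show "x \<in> ?E" by auto
  qed
  ultimately have E: "?E \<in> sets lebesgue"
    using Z by (auto intro!: sets.Diff sets.countable_UN)
  have "negligible (?E \<inter> cball 0 (real k))" for k
    by (rule negligible_disjoint_translates[OF _ _ _ d, of _ e])
      (use E in \<open>auto intro!: bounded_set_imp_lmeasurable\<close>)
  then have "negligible (\<Union>k. ?E \<inter> cball 0 (real k))"
    by (intro negligible_countable_Union) auto
  also have "(\<Union>k. ?E \<inter> cball 0 (real k)) = ?E"
    using real_arch_simple by fastforce
  finally show ?thesis .
qed

subsection \<open>Pointwise inequalities\<close>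

text \<open>For B = D^2u and p \<noteq> 0, DV = |p|^(\<beta>-2) A B with A = I + (\<beta> - 2) p p^T
  / \<sigma>. The right side is tr ((A B)^2), the left (tr (A B))^2 / d. As A B is similar to a
  symmetric matrix, Cauchy-Schwarz on the diagonal of that matrix suffices.\<close>

lemma trace_square_le:
  fixes B :: "'n::finite \<Rightarrow> 'n \<Rightarrow> real" and p :: "'n \<Rightarrow> real"
  assumes sym: "\<And>i j. B i j = B j i" and pos: "0 < (\<Sum>i\<in>UNIV. (p i)\<^sup>2)" and beta: "\<beta> > 1"
  defines "\<sigma> \<equiv> \<Sum>i\<in>UNIV. (p i)\<^sup>2" and "v \<equiv> \<lambda>i. \<Sum>j\<in>UNIV. B i j * p j"
  defines "b \<equiv> (\<Sum>i\<in>UNIV. p i * v i) / \<sigma>"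
  shows "((\<Sum>i\<in>UNIV. B i i) + (\<beta> - 2) * b)\<^sup>2 / real CARD('n)
    \<le> (\<Sum>i\<in>UNIV. \<Sum>j\<in>UNIV. (B i j)\<^sup>2) + 2 * (\<beta> - 2) * ((\<Sum>i\<in>UNIV. (v i)\<^sup>2) / \<sigma>) + (\<beta> - 2)\<^sup>2 * b\<^sup>2"
proof -
  \<comment> \<open>\<open>M = A\<^sup>1\<^sup>/\<^sup>2 B A\<^sup>1\<^sup>/\<^sup>2\<close> for \<open>A = I + (\<beta> - 2) p p\<^sup>T / \<sigma>\<close>, whose square root is \<open>I + a p p\<^sup>T / \<sigma>\<close>.\<close>
  define a where "a = sqrt (\<beta> - 1) - 1"
  have a: "a\<^sup>2 + 2 * a = \<beta> - 2" using beta by (simp add: a_def power2_eq_square algebra_simps)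
  \<comment> \<open>\<open>c\<close> and \<open>d\<close> come from expanding (I + a p p^T /
    \<sigma>) B (I + a p p^T / \<sigma>) with B p = v and p . v = \<sigma> b.\<close>
  define c d where "c = a / \<sigma>" and "d = a\<^sup>2 * b / \<sigma>"
  define M where "M i j = B i j + c * (p i * v j + v i * p j) + d * (p i * p j)" for i j
  define P where "P = (\<Sum>i\<in>UNIV. p i * v i)"
  define V where "V = (\<Sum>i\<in>UNIV. (v i)\<^sup>2)"
  define BB where "BB = (\<Sum>i\<in>UNIV. \<Sum>j\<in>UNIV. (B i j)\<^sup>2)"
  have s0: "\<sigma> > 0" using pos by (simp add: \<sigma>_def)
  have Pb: "P = \<sigma> * b" using s0 by (simp add: b_def P_def)
  have tr: "(\<Sum>i\<in>UNIV. M i i) = (\<Sum>i\<in>UNIV. B i i) + (\<beta> - 2) * b"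
  proof -
    have "(\<Sum>i\<in>UNIV. M i i) = (\<Sum>i\<in>UNIV. B i i) + 2 * c * P + d * \<sigma>"
      unfolding M_def P_def \<sigma>_def by (simp add: sum.distrib sum_distrib_left algebra_simps power2_eq_square)
    also have "\<dots> = (\<Sum>i\<in>UNIV. B i i) + (a\<^sup>2 + 2 * a) * b"
      using s0 by (simp add: c_def d_def Pb field_simps)
    also note a
    finally show ?thesis by (simp add: add.assoc)
  qed
  have e2: "(\<Sum>i\<in>UNIV. \<Sum>j\<in>UNIV. B i j * (p i * v j)) = V"
    unfolding V_def power2_eq_square
    by (subst sum.swap) (simp add: v_def sum_distrib_left sum_distrib_right sym[of _ i for i] algebra_simps)
  have e3: "(\<Sum>i\<in>UNIV. \<Sum>j\<in>UNIV. B i j * (v i * p j)) = V"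
    unfolding V_def power2_eq_square
    by (simp add: v_def sum_distrib_left sum_distrib_right algebra_simps)
  have e4: "(\<Sum>i\<in>UNIV. \<Sum>j\<in>UNIV. B i j * (p i * p j)) = P"
    unfolding P_def by (simp add: v_def sum_distrib_left sum_distrib_right algebra_simps)
  have "(M i j)\<^sup>2 = (B i j)\<^sup>2 + 2 * c * (B i j * (p i * v j)) + 2 * c * (B i j * (v i * p j)) + 2 * d * (B i j * (p i * p j))
     + c\<^sup>2 * ((p i * p i) * (v j * v j)) + c\<^sup>2 * ((v i * v i) * (p j * p j)) + 2 * c\<^sup>2 * ((p i * v i) * (p j * v j))
     + 2 * c * d * ((p i * p i) * (p j * v j)) + 2 * c * d * ((p i * v i) * (p j * p j))
     + d\<^sup>2 * ((p i * p i) * (p j * p j))" for i j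
    unfolding M_def by (simp add: power2_eq_square algebra_simps)
  then have "(\<Sum>i\<in>UNIV. \<Sum>j\<in>UNIV. (M i j)\<^sup>2) = BB + 2 * c * V + 2 * c * V + 2 * d * P
     + c\<^sup>2 * (\<sigma> * V) + c\<^sup>2 * (V * \<sigma>) + 2 * c\<^sup>2 * (P * P) + 2 * c * d * (\<sigma> * P) + 2 * c * d * (P * \<sigma>) + d\<^sup>2 * (\<sigma> * \<sigma>)"
    by (simp only: sum.distrib sum_distrib_left[symmetric] sum_distrib_right[symmetric] e2 e3 e4)
      (simp add: BB_def V_def P_def \<sigma>_def power2_eq_square)
  also have "\<dots> = BB + 2 * (a\<^sup>2 + 2 * a) * (V / \<sigma>) + (a\<^sup>2 + 2 * a)\<^sup>2 * b\<^sup>2"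
  proof -
      have "c * V = a * (V / \<sigma>)" "c\<^sup>2 * (\<sigma> * V) = a\<^sup>2 * (V / \<sigma>)" "d * P = a\<^sup>2 * b * b" "c * P = a * b" "c * d * (\<sigma> * P) = a * (a\<^sup>2 * b) * b" "c\<^sup>2 * (P * P) = a\<^sup>2 * b\<^sup>2"
      "d\<^sup>2 * (\<sigma> * \<sigma>) = (a\<^sup>2 * b)\<^sup>2" 
      using s0 by (auto simp: c_def d_def Pb power2_eq_square field_simps)
    then have "BB + 4 * (c * V) + 2 * (d * P) + 2 * (c\<^sup>2 * (\<sigma> * V)) + 2 * (c\<^sup>2 * (P * P))
        + 4 * (c * d * (\<sigma> * P)) + d\<^sup>2 * (\<sigma> * \<sigma>)
      = BB + 2 * (a\<^sup>2 + 2 * a) * (V / \<sigma>) + (a\<^sup>2 + 2 * a)\<^sup>2 * b\<^sup>2"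
      by (simp only:) (simp add: power2_eq_square algebra_simps)
    then show ?thesis by (simp add: algebra_simps)
  qed
  finally have MM: "(\<Sum>i\<in>UNIV. \<Sum>j\<in>UNIV. (M i j)\<^sup>2) = BB + 2 * (\<beta> - 2) * (V / \<sigma>) + (\<beta> - 2)\<^sup>2 * b\<^sup>2"
    unfolding a .
  have "(\<Sum>i\<in>UNIV. M i i)\<^sup>2 \<le> (\<Sum>i\<in>(UNIV::'n set). 1\<^sup>2) * (\<Sum>i\<in>UNIV. (M i i)\<^sup>2)"
    using Cauchy_Schwarz_ineq_sum[of "\<lambda>_. 1" "\<lambda>i. M i i" UNIV] by simp
  also have "(\<Sum>i\<in>UNIV. (M i i)\<^sup>2) \<le> (\<Sum>i\<in>UNIV. \<Sum>j\<in>UNIV. (M i j)\<^sup>2)"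
    by (intro sum_mono member_le_sum) auto
  finally show ?thesis
    unfolding tr MM[unfolded BB_def V_def] by (simp add: divide_le_eq mult.commute)
qed

text \<open>This is where the constant \<alpha> \<beta> / 4 originates. \<open>tr\<close> bounds the
  bracket by (1 - 1/n) X^2, and \<open>c\<close> leaves at least \<alpha> \<beta> / 4 of X^2,
  exactly what completes the square with the terms in y X and y^2.\<close>

lemma congestion_form_nonneg:
  fixes \<alpha> \<beta> r n \<tau> b BB vv y ww :: real
  assumes pos: "\<alpha> > 0" "\<beta> > 1" "r > 0"
    and tr: "(\<tau> + (\<beta> - 2) * b)\<^sup>2 / n \<le> BB + 2 * (\<beta> - 2) * vv + (\<beta> - 2)\<^sup>2 * b\<^sup>2"
    and yw: "y\<^sup>2 \<le> ww" and c: "\<alpha> * \<beta> / 4 \<le> 1 - (1 - 1 / n) / r"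
  defines "X \<equiv> \<tau> + (\<beta> - 2) * b"
  shows "0 \<le> X\<^sup>2 - (\<tau>\<^sup>2 - BB + 2 * (\<beta> - 2) * (b * \<tau> - vv)) / r - \<alpha> * (\<beta> - 1) * y * X
    + \<alpha> * (\<beta> - 1) / \<beta> * (ww + (\<beta> - 2) * y\<^sup>2)"
proof -
  have "\<tau>\<^sup>2 - BB + 2 * (\<beta> - 2) * (b * \<tau> - vv) = X\<^sup>2 - (BB + 2 * (\<beta> - 2) * vv + (\<beta> - 2)\<^sup>2 * b\<^sup>2)"
    by (simp add: X_def power2_eq_square algebra_simps)
  also have "\<dots> \<le> (1 - 1 / n) * X\<^sup>2" using tr by (simp add: X_def algebra_simps)
  finally have "(\<tau>\<^sup>2 - BB + 2 * (\<beta> - 2) * (b * \<tau> - vv)) / r \<le> (1 - 1 / n) * X\<^sup>2 / r"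
    using pos by (simp add: divide_right_mono)
  then have 1: "(\<tau>\<^sup>2 - BB + 2 * (\<beta> - 2) * (b * \<tau> - vv)) / r \<le> ((1 - 1 / n) / r) * X\<^sup>2" by simp
  have 2: "((1 - 1 / n) / r) * X\<^sup>2 \<le> (1 - \<alpha> * \<beta> / 4) * X\<^sup>2"
    by (rule mult_right_mono) (use c in linarith, simp)
  have 3: "\<alpha> * (\<beta> - 1) / \<beta> * ((\<beta> - 1) * y\<^sup>2) \<le> \<alpha> * (\<beta> - 1) / \<beta> * (ww + (\<beta> - 2) * y\<^sup>2)"
    using pos yw by (intro mult_left_mono) (auto simp: algebra_simps)
  have "0 \<le> \<alpha> / (4 * \<beta>) * (\<beta> * X - 2 * (\<beta> - 1) * y)\<^sup>2" using pos by simp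
  also have "\<dots> = \<alpha> * \<beta> / 4 * X\<^sup>2 - \<alpha> * (\<beta> - 1) * y * X + \<alpha> * (\<beta> - 1) / \<beta> * ((\<beta> - 1) * y\<^sup>2)"
    using pos by (simp add: power2_eq_square field_simps)
  finally show ?thesis using 1 2 3 by (simp add: algebra_simps)
qed

lemma quadratic_lower_bound:
  fixes c A t :: real
  assumes "c > 0"
  shows "c * t\<^sup>2 - A\<^sup>2 / (4 * c) \<le> 2 * c * t\<^sup>2 - A * \<bar>t\<bar>"
proof -
  have "0 \<le> (2 * c * \<bar>t\<bar> - A)\<^sup>2 / (4 * c)" using assms by simp
  also have "\<dots> = c * t\<^sup>2 - A * \<bar>t\<bar> + A\<^sup>2 / (4 * c)"
    using assms by (simp add: power2_diff power_mult_distrib field_simps power2_eq_square)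
  finally show ?thesis by simp
qed

text \<open>This concerns the factor of \<zeta> in the dissipation. Writing \<tau> = X - (\<beta> -
  2) b and using vv \<ge> b^2 produces b^2 (\<beta> - 1) / r = 2 c b^2, while X and y occur only
  through the bounded \<rho> X and \<rho> y; half of the square absorbs the terms linear in
  b.\<close>

lemma cutoff_form_ge:
  fixes \<alpha> \<beta> r \<rho> \<tau> b vv y H Y :: real
  assumes pos: "\<alpha> > 0" "\<beta> > 1" "r > 0" "\<rho> > 0"
    and H: "\<bar>\<rho> * (\<tau> + (\<beta> - 2) * b)\<bar> \<le> H" and Y: "\<bar>\<rho> * y\<bar> \<le> Y" and bv: "b\<^sup>2 \<le> vv"
  defines "X \<equiv> \<tau> + (\<beta> - 2) * b" and "c \<equiv> (\<beta> - 1) / (2 * r)" and "A \<equiv> \<bar>1 - 1 / r\<bar> * H + \<alpha> * (\<beta> - 1) * Y"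
  shows "c * (\<rho> * b)\<^sup>2 - A\<^sup>2 / (4 * c)
    \<le> \<rho>\<^sup>2 * (X * b - (b * \<tau> - vv) / r - \<alpha> * (\<beta> - 1) * y * b + \<alpha> * (\<beta> - 1) / \<beta> * y\<^sup>2)"
proof -
  have c: "c > 0" using pos by (simp add: c_def)
  have "c * (\<rho> * b)\<^sup>2 - A\<^sup>2 / (4 * c) \<le> 2 * c * (\<rho> * b)\<^sup>2 - A * \<bar>\<rho> * b\<bar>"
    by (rule quadratic_lower_bound[OF c])
  also have "\<dots> \<le> 2 * c * (\<rho> * b)\<^sup>2 + (1 - 1 / r) * (\<rho> * X) * (\<rho> * b) - \<alpha> * (\<beta> - 1) * (\<rho> * y) * (\<rho> * b)"
  proof -
    have "\<bar>(1 - 1 / r) * (\<rho> * X) * (\<rho> * b)\<bar> \<le> \<bar>1 - 1 / r\<bar> * H * \<bar>\<rho> * b\<bar>"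
      using H unfolding abs_mult[of _ "\<rho> * b"] abs_mult[of "1 - 1 / r"] X_def
      by (intro mult_right_mono mult_left_mono) auto
    moreover have "\<bar>\<alpha> * (\<beta> - 1) * (\<rho> * y) * (\<rho> * b)\<bar> \<le> \<alpha> * (\<beta> - 1) * Y * \<bar>\<rho> * b\<bar>"
      using Y pos unfolding abs_mult[of _ "\<rho> * b"] abs_mult[of _ "\<rho> * y"]
      by (intro mult_right_mono mult_mono) auto
    moreover have "A * \<bar>\<rho> * b\<bar> = \<bar>1 - 1 / r\<bar> * H * \<bar>\<rho> * b\<bar> + \<alpha> * (\<beta> - 1) * Y * \<bar>\<rho> * b\<bar>"
      by (simp add: A_def distrib_right)
    moreover have "k - z \<le> k + x - y" if "\<bar>x\<bar> \<le> x'" "\<bar>y\<bar> \<le> y'" "z = x' + y'" for k x x' y y' z :: real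
      using that by linarith
    ultimately show ?thesis by blast
  qed
  also have "\<dots> = \<rho>\<^sup>2 * (X * b - (b * \<tau> - b\<^sup>2) / r - \<alpha> * (\<beta> - 1) * y * b)"
    using pos by (simp add: X_def c_def power2_eq_square field_simps)
  also have "\<dots> \<le> \<rho>\<^sup>2 * (X * b - (b * \<tau> - vv) / r - \<alpha> * (\<beta> - 1) * y * b + \<alpha> * (\<beta> - 1) / \<beta> * y\<^sup>2)"
  proof (rule mult_left_mono)
    have "(b * \<tau> - vv) / r \<le> (b * \<tau> - b\<^sup>2) / r" using bv pos by (intro divide_right_mono) auto
    moreover have "0 \<le> \<alpha> * (\<beta> - 1) / \<beta> * y\<^sup>2" using pos by simp
    ultimately show "X * b - (b * \<tau> - b\<^sup>2) / r - \<alpha> * (\<beta> - 1) * y * b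
      \<le> X * b - (b * \<tau> - vv) / r - \<alpha> * (\<beta> - 1) * y * b + \<alpha> * (\<beta> - 1) / \<beta> * y\<^sup>2" by linarith
  qed simp
  finally show ?thesis .
qed

text \<open>The algebra behind \<open>dissipation_eq\<close>: P = M^\<gamma>, A = M^(q+\<gamma>-1),
  and E is the coefficient of Dm in the time derivative of Du. The quantity mv = Dm . D^2u Du, which
  has no sign, cancels between the W_t and the G terms; this is what the factor 1 / r of div (m^r G)
  is for.\<close>

lemma dissipation_identity:
  fixes A P M \<rho> \<sigma> \<eta> \<zeta> \<beta> \<gamma> r \<tau> b BB vv y ww mv g' :: real
  assumes pos: "M > 0" "P > 0" "\<sigma> > 0" "\<beta> > 1" "r > 0"
  defines "X \<equiv> \<tau> + (\<beta> - 2) * b"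
  defines "E \<equiv> \<gamma> * P * \<rho> * \<sigma> / (\<beta> * M) - g'"
  shows "A * ((P * M * \<rho> * X + (1 + \<gamma>) * P * \<rho> * (M * y)) * (\<rho> * (\<eta> * X + \<zeta> * b))
      - (\<rho> * (\<zeta> + (\<beta> - 2) * \<eta>) / \<sigma> * (P * \<rho> * (\<sigma> * b) + E * (M * y)) * (M * y) + \<eta> * \<rho> * (P * \<rho> * mv + E * (M\<^sup>2 * ww / \<sigma>))))
    - A * P * (\<eta> * \<rho>\<^sup>2 * (M * y * \<tau> - mv))
    - A * P * M * (\<rho>\<^sup>2 * (\<zeta> + 2 * (\<beta> - 2) * \<eta>) / \<sigma> * (\<sigma> * b * \<tau> - \<sigma> * vv) + \<eta> * \<rho>\<^sup>2 * (\<tau>\<^sup>2 - BB)) / r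
    = A * P * M * (\<eta> * (\<rho>\<^sup>2 * (X\<^sup>2 - (\<tau>\<^sup>2 - BB + 2 * (\<beta> - 2) * (b * \<tau> - vv)) / r + \<gamma> * y * X - \<gamma> / \<beta> * (ww + (\<beta> - 2) * y\<^sup>2)))
      + \<zeta> * (\<rho>\<^sup>2 * (X * b - (b * \<tau> - vv) / r + \<gamma> * y * b - \<gamma> / \<beta> * y\<^sup>2))
      + \<rho> * g' * M / (P * \<sigma>) * (\<eta> * (ww + (\<beta> - 2) * y\<^sup>2) + \<zeta> * y\<^sup>2))"
proof -
  have 1: "\<rho> * (\<zeta> + (\<beta> - 2) * \<eta>) / \<sigma> * (P * \<rho> * (\<sigma> * b) + E * (M * y)) * (M * y)
    = P * M * \<rho>\<^sup>2 * (\<zeta> + (\<beta> - 2) * \<eta>) * b * y + P * M * (\<gamma> / \<beta> * \<rho>\<^sup>2 - \<rho> * g' * M / (P * \<sigma>)) * (\<zeta> + (\<beta> - 2) * \<eta>) * y\<^sup>2"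
    using pos by (simp add: E_def field_simps power2_eq_square)
  have 2: "\<eta> * \<rho> * (P * \<rho> * mv + E * (M\<^sup>2 * ww / \<sigma>))
    = \<eta> * P * \<rho>\<^sup>2 * mv + P * M * (\<gamma> / \<beta> * \<rho>\<^sup>2 - \<rho> * g' * M / (P * \<sigma>)) * \<eta> * ww"
    using pos by (simp add: E_def field_simps power2_eq_square)
  have 3: "\<rho>\<^sup>2 * (\<zeta> + 2 * (\<beta> - 2) * \<eta>) / \<sigma> * (\<sigma> * b * \<tau> - \<sigma> * vv) = \<rho>\<^sup>2 * (\<zeta> + 2 * (\<beta> - 2) * \<eta>) * (b * \<tau> - vv)"
    using pos by (simp add: field_simps)
  show ?thesis
    unfolding 1 2 3 X_def
    by (simp add: algebra_simps power2_eq_square add_divide_distrib diff_divide_distrib)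
qed

subsection \<open>Convexity from subgradients\<close>

text \<open>The inequality extends to t = a, b by continuity. A proper convex combination of two
  distinct points is interior, and there the two subgradient inequalities are averaged.\<close>

lemma convex_on_Icc_of_subgradients:
  fixes f c :: "real \<Rightarrow> real"
  assumes cont: "continuous_on {a..b} f" and ab: "a < b"
    and sub: "\<And>s t. s \<in> {a<..<b} \<Longrightarrow> t \<in> {a<..<b} \<Longrightarrow> f s + c s * (t - s) \<le> f t"
  shows "convex_on {a..b} f"
proof
  have sub': "f s + c s * (t - s) \<le> f t" if s: "s \<in> {a<..<b}" and t: "t \<in> {a..b}" for s t
  proof -
    have "0 \<le> f t - f s - c s * (t - s)"
    proof (rule continuous_ge_on_closure[of "{a<..<b}" "\<lambda>t. f t - f s - c s * (t - s)"])
      show "continuous_on (closure {a<..<b}) (\<lambda>t. f t - f s - c s * (t - s))"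
        using ab by (auto intro!: continuous_intros cont)
    qed (use sub[OF s] ab t in force)+
    then show ?thesis by simp
  qed
  fix l x y :: real assume l: "0 < l" "l < 1" and xy: "x \<in> {a..b}" "y \<in> {a..b}"
  define w where "w = (1 - l) * x + l * y"
  show "f ((1 - l) *\<^sub>R x + l *\<^sub>R y) \<le> (1 - l) * f x + l * f y"
  proof (cases "x = y")
    case True
    then show ?thesis by (simp add: algebra_simps)
  next
    case False
    have wx: "w - x = l * (y - x)" "y - w = (1 - l) * (y - x)" by (simp_all add: w_def algebra_simps)
    have "w \<in> {a<..<b}"
    proof (cases "x < y")
      case True
      then have "w - x > 0" "y - w > 0" unfolding wx using l by auto
      then show ?thesis using xy by auto
    next
      case False
      then have "w - x < 0" "y - w < 0" unfolding wx using l \<open>x \<noteq> y\<close> by (auto simp: mult_less_0_iff)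
      then show ?thesis using xy by auto
    qed
    from sub'[OF this xy(1)] sub'[OF this xy(2)]
    have "(1 - l) * (f w + c w * (x - w)) + l * (f w + c w * (y - w)) \<le> (1 - l) * f x + l * f y"
      using l by (intro add_mono mult_left_mono) auto
    also have "(1 - l) * (f w + c w * (x - w)) + l * (f w + c w * (y - w)) = f w"
      by (simp add: w_def algebra_simps)
    finally show ?thesis by (simp add: w_def)
  qed
qed (rule convex_closed_interval)

subsection \<open>The equations in terms of directional derivatives\<close>

lemma pd_periodic:
  assumes "smooth_on S f" "open S" "z \<in> S" "\<And>z. z \<in> S \<Longrightarrow> z + c \<in> S" "\<And>z. z \<in> S \<Longrightarrow> f (z + c) = f z"
  shows "pd v f (z + c) = pd v f z"
proof -
  have "has_pd f v (pd v f (z + c)) (z + c)"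
    using assms by (intro smooth_on_has_pd) auto
  then have "has_pd (\<lambda>z. f (z + c)) v (pd v f (z + c)) z"
    unfolding has_pd_def by (simp add: algebra_simps)
  then have "has_pd f v (pd v f (z + c)) z"
    by (rule has_pd_cong_open[rotated 3]) (use assms in auto)
  then show ?thesis
    using smooth_on_has_pd[OF assms(1,2,3), of v] has_pd_unique by blast
qed

lemma gradient_eq_pd:
  fixes f :: "(real^'n) \<times> real \<Rightarrow> real"
  assumes "(f has_derivative F) (at (x, t))"
  shows "gradient (\<lambda>y. f (y, t)) x = (\<chi> i. F (axis i 1, 0))"
proof -
  let ?D = "(\<chi> i. F (axis i 1, 0)) :: real^'n"
  have 1: "((\<lambda>y. f (y, t)) has_derivative (\<lambda>h. F (h, 0))) (at x)"
    by (rule has_derivative_compose[where f = "\<lambda>y. (y, t)" and f' = "\<lambda>h. (h, 0)"])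
      (use assms in \<open>auto intro!: derivative_eq_intros\<close>)
  note lin = has_derivative_linear[OF 1]
  have "F (h, 0) = h \<bullet> ?D" for h
  proof -
    have "h = (\<Sum>i\<in>UNIV. (h $ i) *\<^sub>R axis i 1)"
      using basis_expansion[of h] unfolding scalar_mult_eq_scaleR by simp
    then have "F (h, 0) = F (\<Sum>i\<in>UNIV. (h $ i) *\<^sub>R axis i 1, 0)" by (rule arg_cong)
    also have "\<dots> = (\<Sum>i\<in>UNIV. h $ i * F (axis i 1, 0))"
      using linear_sum[OF lin, of "\<lambda>i. (h $ i) *\<^sub>R axis i 1" UNIV] linear_cmul[OF lin] by simp
    also have "\<dots> = h \<bullet> ?D" by (simp add: inner_vec_def)
    finally show ?thesis .
  qed
  then have D: "GDERIV (\<lambda>y. f (y, t)) x :> ?D"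
    unfolding gderiv_def by (intro has_derivative_eq_rhs[OF 1] ext)
  show ?thesis unfolding gradient_def
  proof (rule the_equality)
    show "GDERIV (\<lambda>y. f (y, t)) x :> ?D" by (rule D)
  next
    fix D' assume "GDERIV (\<lambda>y. f (y, t)) x :> D'"
    then have "(\<lambda>h. h \<bullet> D') = (\<lambda>h. h \<bullet> ?D)"
      using D has_derivative_unique unfolding gderiv_def by blast
    then show "D' = ?D" by (metis vector_eq_ldot)
  qed
qed

abbreviation dx :: "'n \<Rightarrow> (real^'n) \<times> real" where "dx i \<equiv> (axis i 1, 0)"

abbreviation dt :: "(real^'n) \<times> real" where "dt \<equiv> (0, 1)"

text \<open>The two alternatives of the theorem enter only through \<open>threshold\<close>, so that
  \<beta> \<ge> 2 and \<beta> < 2 are treated together.\<close>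

locale congestion_mfg =
  fixes T \<alpha> \<beta> q :: real and g :: "real \<Rightarrow> real" and u m :: "real^'n \<Rightarrow> real \<Rightarrow> real"
  assumes T_pos: "T > 0" and alpha: "\<alpha> > 0" and beta: "\<beta> > 1"
    and g_smooth: "smooth_on {0<..} g" and g_mono: "mono_on {0<..} g"
    and u_smooth: "smooth_torus_time T u" and m_smooth: "smooth_torus_time T m"
    and m_pos: "\<And>x t. t \<in> {0..T} \<Longrightarrow> m x t > 0"
    and solves: "solves_congestion_mfg T \<alpha> \<beta> g u m"
    and exponent_pos: "q + 2 * \<alpha> * (1 - \<beta>) > 0"
    and threshold: "\<alpha> * \<beta> / 4 \<le> 1 - (1 - 1 / real CARD('n)) / (q + 2 * \<alpha> * (1 - \<beta>))"
begin

definition \<gamma> :: real where "\<gamma> = \<alpha> * (1 - \<beta>)"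
definition r :: real where "r = q + 2 * \<gamma>"

text \<open>Time endpoints are left out: on this open set derivatives within the set are ordinary
  ones and both equations hold. The endpoints return through continuity only.\<close>

definition S :: "((real^'n) \<times> real) set" where "S = UNIV \<times> {0<..<T}"
definition U :: "(real^'n) \<times> real \<Rightarrow> real" where "U = (\<lambda>(x, t). u x t)"
definition M :: "(real^'n) \<times> real \<Rightarrow> real" where "M = (\<lambda>(x, t). m x t)"

definition p :: "'n \<Rightarrow> (real^'n) \<times> real \<Rightarrow> real" where "p i = pd (dx i) U"
definition p_t :: "'n \<Rightarrow> (real^'n) \<times> real \<Rightarrow> real" where "p_t i = pd dt (p i)"
definition B :: "'n \<Rightarrow> 'n \<Rightarrow> (real^'n) \<times> real \<Rightarrow> real" where "B i j = pd (dx j) (p i)"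
definition M_x :: "'n \<Rightarrow> (real^'n) \<times> real \<Rightarrow> real" where "M_x i = pd (dx i) M"
definition M_t :: "(real^'n) \<times> real \<Rightarrow> real" where "M_t = pd dt M"

text \<open>With p = Du and B = D^2u these are |p|^2, then B p, which is half the gradient of
  \<sigma>, and the Laplacian of u.\<close>

definition \<sigma> :: "(real^'n) \<times> real \<Rightarrow> real" where "\<sigma> z = (\<Sum>i\<in>UNIV. (p i z)\<^sup>2)"
definition v :: "'n \<Rightarrow> (real^'n) \<times> real \<Rightarrow> real" where "v i z = (\<Sum>j\<in>UNIV. B i j z * p j z)"
definition \<tau> :: "(real^'n) \<times> real \<Rightarrow> real" where "\<tau> z = (\<Sum>i\<in>UNIV. B i i z)"

section \<open>Regularity and periodicity on the open slab\<close>

lemma r_pos: "r > 0" using exponent_pos by (simp add: r_def \<gamma>_def)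

lemma open_S: "open S" unfolding S_def by (intro open_Times) auto

lemma S_shift: "z \<in> S \<Longrightarrow> z + dx i \<in> S" by (auto simp: S_def)

lemma smooth_U: "smooth_on S U" and smooth_M: "smooth_on S M"
  using u_smooth m_smooth
  by (auto simp: smooth_torus_time_def S_def U_def M_def intro!: smooth_on_subset[of "UNIV \<times> {0..T}"])

lemma smooth_pds:
  "smooth_on S (p i)" "smooth_on S (p_t i)" "smooth_on S (B i j)" "smooth_on S (M_x i)" "smooth_on S M_t"
  unfolding p_def p_t_def B_def M_x_def M_t_def
  by (intro smooth_on_pd smooth_U smooth_M open_S)+

lemmas smooths = smooth_U smooth_M smooth_pds smooth_on_pd[OF smooth_pds(3) open_S]
  smooth_on_pd[OF smooth_pds(4) open_S] smooth_on_pd[OF smooth_pds(5) open_S]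

lemmas pds = smooths[THEN smooth_on_has_pd, OF open_S]

lemma has_pd_named:
  assumes "z \<in> S"
  shows "has_pd U (dx i) (p i z) z" "has_pd (p i) (dx j) (B i j z) z" "has_pd (p i) dt (p_t i z) z"
    "has_pd M (dx i) (M_x i z) z" "has_pd M dt (M_t z) z"
  using pds(1)[OF assms, of "dx i"] pds(3)[OF assms, of i "dx j"] pds(3)[OF assms, of i dt]
    pds(2)[OF assms, of "dx i"] pds(2)[OF assms, of dt]
  unfolding p_def B_def p_t_def M_x_def M_t_def .

lemmas continuous_S = smooths[THEN smooth_on_continuous]

lemma B_sym: "z \<in> S \<Longrightarrow> B i j z = B j i z"
  unfolding B_def p_def by (rule pd_commute[OF smooth_U open_S])

lemma pd_B_sym: "z \<in> S \<Longrightarrow> pd (dx i) (B i j) z = pd (dx j) (B i i) z"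
  unfolding B_def[of i] by (rule pd_commute[OF smooth_pds(1) open_S])

lemma p_t_eq: "z \<in> S \<Longrightarrow> p_t i z = pd (dx i) (pd dt U) z"
  unfolding p_t_def p_def by (rule pd_commute[OF smooth_U open_S])

lemma pd_M_commute: "z \<in> S \<Longrightarrow> pd dt (M_x i) z = pd (dx i) M_t z"
  unfolding M_x_def M_t_def by (rule pd_commute[OF smooth_M open_S])

lemma periodic_U_M:
  assumes "z \<in> S"
  shows "U (z + dx i) = U z" "M (z + dx i) = M z"
proof -
  obtain x t where z: "z = (x, t)" "t \<in> {0..T}" using assms by (auto simp: S_def)
  have "\<forall>k. axis i (1::real) $ k \<in> \<int>" by (simp add: axis_def)
  then show "U (z + dx i) = U z" "M (z + dx i) = M z"
    using u_smooth m_smooth z unfolding smooth_torus_time_def torus_periodic_def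
    by (auto simp: U_def M_def)
qed

lemma periodic_pds:
  assumes z: "z \<in> S"
  shows "p j (z + dx i) = p j z" "p_t j (z + dx i) = p_t j z" "B j k (z + dx i) = B j k z"
    "M_x j (z + dx i) = M_x j z" "M_t (z + dx i) = M_t z"
proof -
  note per = pd_periodic[OF _ open_S _ S_shift]
  have p: "p j (z + dx i) = p j z" if "z \<in> S" for z j
    unfolding p_def using that by (intro per smooth_U periodic_U_M)
  then show "p j (z + dx i) = p j z" using z .
  show "p_t j (z + dx i) = p_t j z" "B j k (z + dx i) = B j k z"
    unfolding p_t_def B_def using z by (intro per smooth_pds p; simp)+
  show "M_x j (z + dx i) = M_x j z" "M_t (z + dx i) = M_t z"
    unfolding M_x_def M_t_def using z by (intro per smooth_M periodic_U_M; simp)+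
qed

lemmas periodic = periodic_U_M periodic_pds

lemma M_pos: "z \<in> S \<Longrightarrow> M z > 0"
  using m_pos by (auto simp: S_def M_def)

lemma has_pd_\<sigma>: "z \<in> S \<Longrightarrow> has_pd \<sigma> (dx j) (2 * v j z) z"
  "z \<in> S \<Longrightarrow> has_pd \<sigma> dt (2 * (\<Sum>k\<in>UNIV. p k z * p_t k z)) z"
proof -
  assume z: "z \<in> S"
  show "has_pd \<sigma> (dx j) (2 * v j z) z"
    unfolding \<sigma>_def power2_eq_square
    by (rule has_pd_eq, rule has_pd_sum, rule has_pd_mult; (rule has_pd_named[OF z])?)
      (auto simp: v_def sum_distrib_left B_sym[OF z, of j] intro!: sum.cong)
  show "has_pd \<sigma> dt (2 * (\<Sum>k\<in>UNIV. p k z * p_t k z)) z"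
    unfolding \<sigma>_def power2_eq_square
    by (rule has_pd_eq, rule has_pd_sum, rule has_pd_mult; (rule has_pd_named[OF z])?)
      (auto simp: sum_distrib_left intro!: sum.cong)
qed

lemma continuous_\<sigma>: "continuous_on S \<sigma>"
  unfolding \<sigma>_def by (intro continuous_intros continuous_S)

lemma \<sigma>_nonneg: "\<sigma> z \<ge> 0" unfolding \<sigma>_def by (simp add: sum_nonneg)

lemma p_eq_0: "\<sigma> z = 0 \<Longrightarrow> p i z = 0"
  unfolding \<sigma>_def by (simp add: sum_nonneg_eq_0_iff)

lemma gradient_u: "(x, t) \<in> S \<Longrightarrow> gradient (\<lambda>y. u y t) x = (\<chi> i. p i (x, t))"
  using gradient_eq_pd[OF smooth_on_has_derivative[OF smooth_U open_S]]
  by (simp add: U_def p_def pd_def)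

lemma norm_gradient_u: "(x, t) \<in> S \<Longrightarrow> norm (gradient (\<lambda>y. u y t) x) powr e = \<sigma> (x, t) powr (e / 2)"
proof -
  assume z: "(x, t) \<in> S"
  have "norm (gradient (\<lambda>y. u y t) x) = sqrt (\<sigma> (x, t))"
    unfolding gradient_u[OF z] by (simp add: norm_vec_def L2_set_def \<sigma>_def)
  also have "\<dots> = \<sigma> (x, t) powr (1 / 2)" using powr_half_sqrt[OF \<sigma>_nonneg] by simp
  finally show ?thesis by (simp add: powr_powr)
qed

lemma deriv_time:
  assumes "(x, t) \<in> S"
  shows "deriv (u x) t = pd dt U (x, t)" "deriv (m x) t = M_t (x, t)"
proof -
  have "((\<lambda>s. u x (s + t)) has_real_derivative pd dt U (x, t)) (at 0)"
    "((\<lambda>s. m x (s + t)) has_real_derivative M_t (x, t)) (at 0)"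
    using pds(1)[OF assms, of dt] has_pd_named(5)[OF assms]
    by (simp_all add: has_pd_def U_def M_def add.commute)
  then show "deriv (u x) t = pd dt U (x, t)" "deriv (m x) t = M_t (x, t)"
    using DERIV_shift[of "u x" _ 0 t] DERIV_shift[of "m x" _ 0 t] by (auto intro!: DERIV_imp_deriv)
qed

section \<open>Pointwise forms of the two equations\<close>

lemma hamilton_jacobi:
  assumes "z \<in> S"
  shows "pd dt U z = M z powr \<gamma> * (\<sigma> z powr (\<beta> / 2) / \<beta>) - g (M z)"
proof -
  obtain x t where z: "z = (x, t)" "t \<in> {0<..<T}" using assms by (auto simp: S_def)
  have "- deriv (u x) t + m x t powr (\<alpha> * (1 - \<beta>)) * (norm (gradient (\<lambda>y. u y t) x) powr \<beta> / \<beta>) = g (m x t)"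
    using solves z(2) unfolding solves_congestion_mfg_def by blast
  then show ?thesis
    using assms norm_gradient_u[of x t] deriv_time[of x t] by (simp add: z(1) M_def \<gamma>_def)
qed

lemma divergence_eq:
  assumes "z \<in> S"
  shows "\<exists>F'. (\<forall>i. has_pd (\<lambda>z. M z powr (1 + \<gamma>) * \<sigma> z powr ((\<beta> - 2) / 2) * p i z) (dx i) (F' i) z)
    \<and> M_t z = (\<Sum>i\<in>UNIV. F' i)"
proof -
  obtain x t where z: "z = (x, t)" "t \<in> {0<..<T}" using assms by (auto simp: S_def)
  have S: "(y, t) \<in> S" for y using z by (simp add: S_def)
  have "has_divergence
          (\<lambda>y. (m y t powr (1 + \<alpha> * (1 - \<beta>)) * norm (gradient (\<lambda>z. u z t) y) powr (\<beta> - 2))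
                 *\<^sub>R gradient (\<lambda>z. u z t) y)
          (deriv (m x) t) x"
    using solves z(2) unfolding solves_congestion_mfg_def by blast
  then show ?thesis
    unfolding has_divergence_def gradient_u[OF S] norm_gradient_u[OF S, unfolded gradient_u[OF S]]
      deriv_time[OF S] has_pd_def
    by (simp add: z(1) M_def \<gamma>_def)
qed

text \<open>Where Du \<noteq> 0 the flux can be differentiated by the product rule, and uniqueness
  identifies the result with the partial derivatives granted by the equation. The factor \<rho>
  (\<tau> + (\<beta> - 2) b) is div V.\<close>

lemma M_t_eq:
  assumes z: "z \<in> S" and pos: "\<sigma> z > 0"
  defines "\<rho> \<equiv> \<sigma> z powr ((\<beta> - 2) / 2)" and "b \<equiv> (\<Sum>i\<in>UNIV. p i z * v i z) / \<sigma> z"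
  shows "M_t z = M z powr \<gamma> * M z * \<rho> * (\<tau> z + (\<beta> - 2) * b)
    + (1 + \<gamma>) * M z powr \<gamma> * \<rho> * (\<Sum>i\<in>UNIV. M_x i z * p i z)"
proof -
  let ?k = "(\<beta> - 2) / 2"
  obtain F' where F': "\<And>i. has_pd (\<lambda>z. M z powr (1 + \<gamma>) * \<sigma> z powr ?k * p i z) (dx i) (F' i) z"
    and M_t: "M_t z = (\<Sum>i\<in>UNIV. F' i)"
    using divergence_eq[OF z] by blast
  have "F' i = ((1 + \<gamma>) * M z powr (1 + \<gamma> - 1) * M_x i z * \<sigma> z powr ?k
      + M z powr (1 + \<gamma>) * (?k * \<sigma> z powr (?k - 1) * (2 * v i z))) * p i z
      + M z powr (1 + \<gamma>) * \<sigma> z powr ?k * B i i z" for i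
    by (rule has_pd_unique[OF F'])
      (intro has_pd_mult has_pd_powr has_pd_named has_pd_\<sigma> z M_pos pos)
  moreover have "1 + \<gamma> - 1 = \<gamma>" "M z powr (1 + \<gamma>) = M z powr \<gamma> * M z" "\<sigma> z powr (?k - 1) = \<rho> / \<sigma> z" "\<sigma> z powr ?k = \<rho>"
    using M_pos[OF z] pos by (simp_all add: powr_add powr_diff \<rho>_def)
  ultimately have F'_eq: "F' i = ((1 + \<gamma>) * M z powr \<gamma> * M_x i z * \<rho>
      + M z powr \<gamma> * M z * (?k * (\<rho> / \<sigma> z) * (2 * v i z))) * p i z
      + M z powr \<gamma> * M z * \<rho> * B i i z" for i
    by (simp only:)
  have "F' i = (1 + \<gamma>) * M z powr \<gamma> * \<rho> * (M_x i z * p i z)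
      + M z powr \<gamma> * M z * \<rho> * ((\<beta> - 2) / \<sigma> z) * (p i z * v i z)
      + M z powr \<gamma> * M z * \<rho> * B i i z" for i
    unfolding F'_eq using pos by (simp add: field_simps)
  then have "M_t z = (1 + \<gamma>) * M z powr \<gamma> * \<rho> * (\<Sum>i\<in>UNIV. M_x i z * p i z)
      + M z powr \<gamma> * M z * \<rho> * ((\<beta> - 2) / \<sigma> z) * (\<Sum>i\<in>UNIV. p i z * v i z)
      + M z powr \<gamma> * M z * \<rho> * \<tau> z"
    unfolding M_t \<tau>_def sum_distrib_left sum.distrib[symmetric] by (intro sum.cong refl)
  then show ?thesis by (simp add: b_def algebra_simps)
qed

lemma deriv_g_nonneg: "s > 0 \<Longrightarrow> (g has_real_derivative deriv g s) (at s) \<and> deriv g s \<ge> 0"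
proof
  assume s: "s > 0"
  have "g differentiable (at s)"
    using smooth_on_has_derivative[OF g_smooth open_greaterThan, of s] s differentiable_def by auto
  then show d: "(g has_real_derivative deriv g s) (at s)"
    using DERIV_deriv_iff_real_differentiable by blast
  show "deriv g s \<ge> 0"
    by (rule mono_on_imp_deriv_nonneg[OF g_mono d]) (use s in \<open>auto simp: interior_open\<close>)
qed

text \<open>The first equation is differentiated in space, after exchanging the time and space
  derivatives of u.\<close>

lemma p_t_eq_pos:
  assumes z: "z \<in> S" and pos: "\<sigma> z > 0"
  defines "\<rho> \<equiv> \<sigma> z powr ((\<beta> - 2) / 2)"
  shows "p_t i z = M z powr \<gamma> * \<rho> * v i z
    + (\<gamma> * M z powr \<gamma> * \<rho> * \<sigma> z / (\<beta> * M z) - deriv g (M z)) * M_x i z"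
proof -
  have "has_pd (\<lambda>z. M z powr \<gamma> * (\<sigma> z powr (\<beta> / 2) * inverse \<beta>) - g (M z)) (dx i)
    (\<gamma> * M z powr (\<gamma> - 1) * M_x i z * (\<sigma> z powr (\<beta> / 2) * inverse \<beta>)
     + M z powr \<gamma> * ((\<beta> / 2) * \<sigma> z powr (\<beta> / 2 - 1) * (2 * v i z) * inverse \<beta> + \<sigma> z powr (\<beta> / 2) * 0)
     - deriv g (M z) * M_x i z) z"
    by (intro has_pd_diff has_pd_mult has_pd_powr has_pd_named has_pd_\<sigma> has_pd_const has_pd_compose[where h = g]
        z M_pos pos conjunct1[OF deriv_g_nonneg])
  then have "has_pd (pd dt U) (dx i)
    (\<gamma> * M z powr (\<gamma> - 1) * M_x i z * (\<sigma> z powr (\<beta> / 2) * inverse \<beta>)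
     + M z powr \<gamma> * ((\<beta> / 2) * \<sigma> z powr (\<beta> / 2 - 1) * (2 * v i z) * inverse \<beta> + \<sigma> z powr (\<beta> / 2) * 0)
     - deriv g (M z) * M_x i z) z"
    by (rule has_pd_cong_open[OF open_S z, rotated]) (simp add: hamilton_jacobi divide_inverse[of _ \<beta>])
  moreover have "has_pd (pd dt U) (dx i) (p_t i z) z"
    unfolding p_t_eq[OF z] by (intro smooth_on_has_pd[OF _ open_S z] smooth_on_pd smooth_U open_S)
  ultimately have "p_t i z = \<gamma> * M z powr (\<gamma> - 1) * M_x i z * (\<sigma> z powr (\<beta> / 2) * inverse \<beta>)
     + M z powr \<gamma> * ((\<beta> / 2) * \<sigma> z powr (\<beta> / 2 - 1) * (2 * v i z) * inverse \<beta> + \<sigma> z powr (\<beta> / 2) * 0)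
     - deriv g (M z) * M_x i z"
    using has_pd_unique by blast
  moreover have "\<sigma> z powr (\<beta> / 2) = \<rho> * \<sigma> z" "\<sigma> z powr (\<beta> / 2 - 1) = \<rho>" "M z powr (\<gamma> - 1) = M z powr \<gamma> / M z"
    using pos M_pos[OF z] by (auto simp: \<rho>_def powr_diff diff_divide_distrib)
  ultimately show ?thesis
    using beta M_pos[OF z] by (simp add: field_simps)
qed

subsection \<open>The truncated flux\<close>

text \<open>This is \<eta> V; the exponent is halved because the cutoff is applied to \<sigma> =
  |p|^2.\<close>

definition W :: "real \<Rightarrow> 'n \<Rightarrow> (real^'n) \<times> real \<Rightarrow> real" where
  "W L i z = cutoff L ((\<beta> - 2) / 2) (\<sigma> z) * p i z"

definition W_x :: "real \<Rightarrow> 'n \<Rightarrow> 'n \<Rightarrow> (real^'n) \<times> real \<Rightarrow> real" where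
  "W_x L i j z = cutoff_deriv L ((\<beta> - 2) / 2) (\<sigma> z) * (2 * v j z) * p i z
     + cutoff L ((\<beta> - 2) / 2) (\<sigma> z) * B i j z"

definition W_t :: "real \<Rightarrow> 'n \<Rightarrow> (real^'n) \<times> real \<Rightarrow> real" where
  "W_t L i z = cutoff_deriv L ((\<beta> - 2) / 2) (\<sigma> z) * (2 * (\<Sum>k\<in>UNIV. p k z * p_t k z)) * p i z
     + cutoff L ((\<beta> - 2) / 2) (\<sigma> z) * p_t i z"

text \<open>With \<open>V = p |p|\<^bsup>\<beta>-2\<^esup>\<close>, this is the field \<open>V div W - (D W) V\<close>; the derivatives of the cutoff
  cancel in it.\<close>

definition G :: "real \<Rightarrow> 'n \<Rightarrow> (real^'n) \<times> real \<Rightarrow> real" where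
  "G L i z = cutoff L (\<beta> - 2) (\<sigma> z) * (p i z * \<tau> z - v i z)"

definition G_x :: "real \<Rightarrow> 'n \<Rightarrow> (real^'n) \<times> real \<Rightarrow> real" where
  "G_x L i z = cutoff_deriv L (\<beta> - 2) (\<sigma> z) * (2 * v i z) * (p i z * \<tau> z - v i z)
     + cutoff L (\<beta> - 2) (\<sigma> z) * (B i i z * \<tau> z + p i z * (\<Sum>k\<in>UNIV. pd (dx i) (B k k) z)
         - (\<Sum>j\<in>UNIV. pd (dx i) (B i j) z * p j z + B i j z * B j i z))"

lemma has_pd_W:
  assumes "L > 0" "z \<in> S"
  shows "has_pd (W L i) (dx j) (W_x L i j z) z" "has_pd (W L i) dt (W_t L i z) z"
  unfolding W_def W_x_def W_t_def
  by (intro has_pd_mult has_pd_named has_pd_compose[OF DERIV_cutoff] has_pd_\<sigma> assms)+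

lemma has_pd_v_\<tau>:
  assumes "z \<in> S"
  shows "has_pd (v i) (dx k) (\<Sum>j\<in>UNIV. pd (dx k) (B i j) z * p j z + B i j z * B j k z) z"
    "has_pd \<tau> (dx k) (\<Sum>i\<in>UNIV. pd (dx k) (B i i) z) z"
  unfolding v_def \<tau>_def by (intro has_pd_mult has_pd_sum has_pd_named pds assms)+

lemma has_pd_G:
  assumes "L > 0" "z \<in> S"
  shows "has_pd (G L i) (dx i) (G_x L i z) z"
  unfolding G_def G_x_def
  by (intro has_pd_mult has_pd_diff has_pd_named has_pd_v_\<tau> has_pd_compose[OF DERIV_cutoff] has_pd_\<sigma> assms)

lemma continuous_v_\<tau>: "continuous_on S (v i)" "continuous_on S \<tau>"
  unfolding v_def \<tau>_def by (intro continuous_intros continuous_S)+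

lemma continuous_cutoff_\<sigma>:
  assumes "L > 0"
  shows "continuous_on S (\<lambda>z. cutoff L k (\<sigma> z))" "continuous_on S (\<lambda>z. cutoff_deriv L k (\<sigma> z))"
  using continuous_on_compose2[OF continuous_on_cutoff[OF assms, of UNIV] continuous_\<sigma>]
    continuous_on_compose2[OF continuous_on_cutoff_deriv[OF assms, of UNIV] continuous_\<sigma>]
  by auto

lemma continuous_fields:
  assumes "L > 0"
  shows "continuous_on S (W L i)" "continuous_on S (W_x L i j)" "continuous_on S (W_t L i)"
    "continuous_on S (G L i)" "continuous_on S (G_x L i)"
  unfolding W_def W_x_def W_t_def G_def G_x_def
  by (intro continuous_intros continuous_S continuous_v_\<tau> continuous_cutoff_\<sigma> assms)+

lemma continuous_M_powr: "continuous_on S (\<lambda>z. M z powr e)"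
  by (intro continuous_on_powr continuous_on_const continuous_S) (use M_pos in fastforce)

lemma continuous_divide_r: "continuous_on S F \<Longrightarrow> continuous_on S (\<lambda>z. F z / r)"
  by (rule continuous_on_divide[OF _ continuous_on_const]) (use r_pos in auto)

lemmas continuous_all = continuous_on_add continuous_on_diff continuous_on_minus continuous_on_mult
  continuous_on_sum continuous_on_const continuous_divide_r continuous_fields continuous_M_powr continuous_S continuous_v_\<tau>
  continuous_cutoff_\<sigma>

lemma periodic_fields:
  assumes "z \<in> S"
  shows "\<sigma> (z + dx i) = \<sigma> z" "W L j (z + dx i) = W L j z" "G L j (z + dx i) = G L j z"
  unfolding W_def G_def \<sigma>_def v_def \<tau>_def by (simp_all add: periodic assms)

section \<open>Integrals over time slices\<close>

lemma integrable_slice: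
  fixes F :: "(real^'n) \<times> real \<Rightarrow> real"
  assumes "continuous_on S F" "t \<in> {0<..<T}"
  shows "(\<lambda>x. F (x, t)) integrable_on cbox 0 One"
  by (rule integrable_continuous, rule continuous_on_compose2[OF assms(1)])
    (use assms(2) in \<open>auto simp: S_def intro!: continuous_intros\<close>)

lemma torus_integral_divergence_eq_0:
  assumes der: "\<And>i z. z \<in> S \<Longrightarrow> has_pd (F i) (dx i) (D i z) z"
    and cont: "\<And>i. continuous_on S (F i)" "\<And>i. continuous_on S (D i)"
    and per: "\<And>i z. z \<in> S \<Longrightarrow> F i (z + dx i) = F i z" and t: "t \<in> {0<..<T}"
  shows "torus_integral (\<lambda>x. \<Sum>i\<in>UNIV. D i (x, t)) = 0"
proof -
  have S: "(x, t) \<in> S" for x using t by (simp add: S_def)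
  have "torus_integral (\<lambda>x. D i (x, t)) = 0" for i
  proof (rule torus_integral_pd_eq_0[of "\<lambda>x. F i (x, t)" i])
    show "F i (x + axis i 1, t) = F i (x, t)" for x using per[OF S[of x], of i] by simp
    show "has_pd (\<lambda>x. F i (x, t)) (axis i 1) (D i (x, t)) x" for x
      using der[OF S[of x], of i] by (simp add: has_pd_def)
    show "continuous_on UNIV (\<lambda>x. F i (x, t))" "continuous_on UNIV (\<lambda>x. D i (x, t))"
      using S by (auto intro!: continuous_on_compose2[OF cont(1)] continuous_on_compose2[OF cont(2)] continuous_intros)
  qed
  then show ?thesis
    unfolding torus_integral_def by (subst integral_sum) (auto intro!: integrable_slice cont t)
qed

lemma DERIV_torus_integral:
  assumes der: "\<And>z. z \<in> S \<Longrightarrow> has_pd F dt (D z) z"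
    and cont: "continuous_on S F" "continuous_on S D" and t: "t \<in> {0<..<T}"
  shows "((\<lambda>t. torus_integral (\<lambda>x. F (x, t))) has_real_derivative torus_integral (\<lambda>x. D (x, t))) (at t)"
proof -
  have "((\<lambda>t. integral (cbox 0 One) (\<lambda>x. F (x, t))) has_field_derivative
      integral (cbox 0 One) (\<lambda>x. D (x, t))) (at t within {0<..<T})"
  proof (rule leibniz_rule_field_derivative)
    fix s x assume "s \<in> {0<..<T}"
    then have "has_pd F dt (D (x, s)) (x, s)" by (intro der) (simp add: S_def)
    then have "((\<lambda>h. F (x, h + s)) has_real_derivative D (x, s)) (at 0)"
      by (simp add: has_pd_def add.commute)
    then show "((\<lambda>s. F (x, s)) has_field_derivative D (x, s)) (at s within {0<..<T})"
      using DERIV_shift[of "\<lambda>s. F (x, s)" _ 0 s] by (auto intro: DERIV_subset)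
  next
    show "(\<lambda>x. F (x, s)) integrable_on cbox 0 One" if "s \<in> {0<..<T}" for s
      using integrable_slice[OF cont(1) that] .
    show "continuous_on ({0<..<T} \<times> cbox 0 One) (\<lambda>(s, x). D (x, s))"
      unfolding split_beta
      by (rule continuous_on_compose2[OF cont(2)]) (auto simp: S_def intro!: continuous_intros)
  qed (use t in auto)
  then show ?thesis using t by (simp add: torus_integral_def at_within_open[OF t open_greaterThanLessThan])
qed

lemma continuous_torus_integral:
  assumes "continuous_on S F"
  shows "continuous_on {0<..<T} (\<lambda>t. torus_integral (\<lambda>x. F (x, t)))"
  unfolding torus_integral_def
  by (rule integral_continuous_on_param, unfold split_beta, rule continuous_on_compose2[OF assms])
    (auto simp: S_def intro!: continuous_intros)

section \<open>Truncated flux, dissipation and defect\<close>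

definition flux_density :: "real \<Rightarrow> (real^'n) \<times> real \<Rightarrow> real" where
  "flux_density L z = (\<Sum>i\<in>UNIV. - (M z powr (q + \<gamma> - 1) * M_x i z * W L i z))"

text \<open>Only its integral is the derivative of the flux: the divergence of \<open>m\<^sup>r G / r\<close> is subtracted to
  make it a quadratic form.\<close>

definition dissipation :: "real \<Rightarrow> (real^'n) \<times> real \<Rightarrow> real" where
  "dissipation L z = (\<Sum>i\<in>UNIV. M z powr (q + \<gamma> - 1) * (M_t z * W_x L i i z - M_x i z * W_t L i z)
      - (r * M z powr (r - 1) * M_x i z * G L i z + M z powr r * G_x L i z) / r)"

lemma continuous_flux_density: "L > 0 \<Longrightarrow> continuous_on S (flux_density L)"
  unfolding flux_density_def by (intro continuous_all)

lemma continuous_dissipation: "L > 0 \<Longrightarrow> continuous_on S (dissipation L)"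
  unfolding dissipation_def by (intro continuous_all)

text \<open>The part of the time derivative that falls on m^e Dm, e = q + \<gamma> - 1, is the space
  gradient of m^e m_t. Integration by parts moves it onto W, and a further divergence, that of m^r G
  / r, integrates to 0.\<close>

lemma DERIV_flux:
  assumes L: "L > 0" and t: "t \<in> {0<..<T}"
  shows "((\<lambda>t. torus_integral (\<lambda>x. flux_density L (x, t))) has_real_derivative
    torus_integral (\<lambda>x. dissipation L (x, t))) (at t)"
proof -
  let ?e = "q + \<gamma> - 1"
  define D where "D i z = - ((?e * M z powr (?e - 1) * M_t z * M_x i z + M z powr ?e * pd dt (M_x i) z) * W L i z
     + M z powr ?e * M_x i z * W_t L i z)" for i z
  have D: "has_pd (flux_density L) dt (\<Sum>i\<in>UNIV. D i z) z" if "z \<in> S" for z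
    unfolding flux_density_def D_def
    by (intro has_pd_sum has_pd_minus has_pd_mult has_pd_powr has_pd_named has_pd_W pds that L M_pos)
  have contD: "continuous_on S (\<lambda>z. \<Sum>i\<in>UNIV. D i z)"
    unfolding D_def by (intro continuous_all L)
  \<comment> \<open>The time derivative of the density minus \<open>dissipation\<close> is the
    divergence of \<open>F\<close>.\<close>
  define F where "F i z = M z powr r * G L i z / r - M z powr ?e * M_t z * W L i z" for i z
  define E where "E i z = (r * M z powr (r - 1) * M_x i z * G L i z + M z powr r * G_x L i z) / r
     - ((?e * M z powr (?e - 1) * M_x i z * M_t z + M z powr ?e * pd (dx i) M_t z) * W L i z
       + M z powr ?e * M_t z * W_x L i i z)" for i z
  have E: "has_pd (F i) (dx i) (E i z) z" if "z \<in> S" for i z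
  proof -
    have "has_pd (\<lambda>z. M z powr r * G L i z * (1 / r) - M z powr ?e * M_t z * W L i z) (dx i)
     ((r * M z powr (r - 1) * M_x i z * G L i z + M z powr r * G_x L i z) * (1 / r) + M z powr r * G L i z * 0
     - ((?e * M z powr (?e - 1) * M_x i z * M_t z + M z powr ?e * pd (dx i) M_t z) * W L i z
       + M z powr ?e * M_t z * W_x L i i z)) z"
    by (intro has_pd_diff has_pd_mult has_pd_powr has_pd_named has_pd_W has_pd_G has_pd_const pds that L M_pos)
    then show ?thesis by (simp add: F_def[abs_def] E_def)
  qed
  have contE: "continuous_on S (F i)" "continuous_on S (E i)" for i
    unfolding E_def F_def by (intro continuous_all L)+
  have "F i (z + dx i) = F i z" if "z \<in> S" for i z
    using that by (simp add: F_def periodic periodic_fields)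
  from torus_integral_divergence_eq_0[OF E contE this t]
  have zero: "torus_integral (\<lambda>x. \<Sum>i\<in>UNIV. E i (x, t)) = 0" .
  have sum: "(\<Sum>i\<in>UNIV. D i z) = dissipation L z + (\<Sum>i\<in>UNIV. E i z)" if "z \<in> S" for z
    unfolding dissipation_def sum.distrib[symmetric]
    by (intro sum.cong refl) (simp add: D_def E_def pd_M_commute[OF that] algebra_simps)
  have "torus_integral (\<lambda>x. \<Sum>i\<in>UNIV. D i (x, t)) = torus_integral (\<lambda>x. dissipation L (x, t) + (\<Sum>i\<in>UNIV. E i (x, t)))"
    unfolding torus_integral_def using t by (intro integral_cong) (simp add: sum S_def)
  also have "\<dots> = torus_integral (\<lambda>x. dissipation L (x, t)) + torus_integral (\<lambda>x. \<Sum>i\<in>UNIV. E i (x, t))"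
    unfolding torus_integral_def
    by (intro integral_add integrable_slice[OF _ t] continuous_dissipation L) 
      (intro integrable_slice[OF _ t, of "\<lambda>z. \<Sum>i\<in>UNIV. E i z"] continuous_intros contE)
  finally show ?thesis
    using DERIV_torus_integral[OF D continuous_flux_density[OF L] contD t] zero by simp
qed

text \<open>The exponent 0 makes \<open>cutoff L 0\<close> the bare factor \<eta>, extended by 0 to
  \<sigma> = 0.\<close>

definition mass_density :: "real \<Rightarrow> (real^'n) \<times> real \<Rightarrow> real" where
  "mass_density L z = cutoff L 0 (\<sigma> z) * M z powr (q - 1) * M_t z"

text \<open>Without cutoff, m^(q-1) m_t is (q - 1) times the flux density plus the divergence of
  m^(q+\<gamma>) V, by the second equation; this is the error in the same identity with
  \<eta>.\<close>

definition defect :: "real \<Rightarrow> (real^'n) \<times> real \<Rightarrow> real" where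
  "defect L z = mass_density L z - (q - 1) * flux_density L z
     - (\<Sum>i\<in>UNIV. (q + \<gamma>) * M z powr (q + \<gamma> - 1) * M_x i z * W L i z + M z powr (q + \<gamma>) * W_x L i i z)"

lemma continuous_mass_density: "L > 0 \<Longrightarrow> continuous_on S (mass_density L)"
  unfolding mass_density_def by (intro continuous_all)

lemma continuous_defect: "L > 0 \<Longrightarrow> continuous_on S (defect L)"
  unfolding defect_def by (intro continuous_all continuous_mass_density continuous_flux_density)

lemma torus_integral_defect:
  assumes L: "L > 0" and t: "t \<in> {0<..<T}"
  shows "torus_integral (\<lambda>x. defect L (x, t))
    = torus_integral (\<lambda>x. mass_density L (x, t)) - (q - 1) * torus_integral (\<lambda>x. flux_density L (x, t))"
proof -
  define E where "E i z = (q + \<gamma>) * M z powr (q + \<gamma> - 1) * M_x i z * W L i z + M z powr (q + \<gamma>) * W_x L i i z" for i z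
  have E: "has_pd (\<lambda>z. M z powr (q + \<gamma>) * W L i z) (dx i) (E i z) z" if "z \<in> S" for i z
    unfolding E_def by (intro has_pd_mult has_pd_powr has_pd_named has_pd_W that L M_pos)
  have contE: "continuous_on S (\<lambda>z. M z powr (q + \<gamma>) * W L i z)" "continuous_on S (E i)" for i
    unfolding E_def by (intro continuous_all L)+
  have "M (z + dx i) powr (q + \<gamma>) * W L i (z + dx i) = M z powr (q + \<gamma>) * W L i z" if "z \<in> S" for i z
    using that by (simp add: periodic periodic_fields)
  from torus_integral_divergence_eq_0[OF E contE this t]
  have zero: "torus_integral (\<lambda>x. \<Sum>i\<in>UNIV. E i (x, t)) = 0" .
  note int = integrable_slice[OF continuous_mass_density[OF L] t] integrable_slice[OF continuous_flux_density[OF L] t]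
  have intE: "(\<lambda>x. \<Sum>i\<in>UNIV. E i (x, t)) integrable_on cbox 0 One"
    by (intro integrable_slice[OF _ t, of "\<lambda>z. \<Sum>i\<in>UNIV. E i z"] continuous_intros contE)
  have "torus_integral (\<lambda>x. defect L (x, t)) = torus_integral (\<lambda>x. mass_density L (x, t))
     - torus_integral (\<lambda>x. (q - 1) * flux_density L (x, t)) - torus_integral (\<lambda>x. \<Sum>i\<in>UNIV. E i (x, t))"
    unfolding torus_integral_def defect_def E_def[symmetric]
    using int(2)[THEN integrable_on_cmult_left, of "q - 1"]
    by (simp add: integral_diff integrable_diff int intE)
  then show ?thesis using zero by (simp add: torus_integral_def)
qed

text \<open>The third derivatives of u cancel: by symmetry, the sum over i of the derivatives of
  \<open>B i j\<close> in direction i is the derivative of \<tau> in direction j.\<close>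

lemma sum_G_x:
  assumes z: "z \<in> S"
  shows "(\<Sum>i\<in>UNIV. G_x L i z)
    = 2 * cutoff_deriv L (\<beta> - 2) (\<sigma> z) * ((\<Sum>i\<in>UNIV. p i z * v i z) * \<tau> z - (\<Sum>i\<in>UNIV. (v i z)\<^sup>2))
      + cutoff L (\<beta> - 2) (\<sigma> z) * ((\<tau> z)\<^sup>2 - (\<Sum>i\<in>UNIV. \<Sum>j\<in>UNIV. (B i j z)\<^sup>2))"
proof -
  let ?c = "cutoff L (\<beta> - 2) (\<sigma> z)" and ?d = "cutoff_deriv L (\<beta> - 2) (\<sigma> z)"
  have "(\<Sum>i\<in>UNIV. \<Sum>j\<in>UNIV. pd (dx i) (B i j) z * p j z) = (\<Sum>j\<in>UNIV. \<Sum>i\<in>UNIV. pd (dx i) (B i j) z * p j z)"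
    by (rule sum.swap)
  also have "\<dots> = (\<Sum>i\<in>UNIV. \<Sum>k\<in>UNIV. p i z * pd (dx i) (B k k) z)"
    by (intro sum.cong refl) (simp add: pd_B_sym[OF z])
  finally have third: "(\<Sum>i\<in>UNIV. \<Sum>j\<in>UNIV. pd (dx i) (B i j) z * p j z) = (\<Sum>i\<in>UNIV. p i z * (\<Sum>k\<in>UNIV. pd (dx i) (B k k) z))"
    by (simp add: sum_distrib_left)
  define Q where "Q i = (\<Sum>k\<in>UNIV. pd (dx i) (B k k) z)" for i
  define R where "R i = (\<Sum>j\<in>UNIV. pd (dx i) (B i j) z * p j z)" for i
  define H where "H i = (\<Sum>j\<in>UNIV. (B i j z)\<^sup>2)" for i
  have BB: "B i j z * B j i z = (B i j z)\<^sup>2" for i j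
    unfolding B_sym[OF z, of j i] by (simp add: power2_eq_square)
  have "G_x L i z = 2 * ?d * (p i z * v i z * \<tau> z - (v i z)\<^sup>2) + ?c * (B i i z * \<tau> z + p i z * Q i - R i - H i)" for i
    unfolding G_x_def Q_def[symmetric] BB sum.distrib R_def[symmetric] H_def[symmetric]
    by (simp add: power2_eq_square algebra_simps)
  then have "(\<Sum>i\<in>UNIV. G_x L i z) = 2 * ?d * (\<Sum>i\<in>UNIV. p i z * v i z * \<tau> z - (v i z)\<^sup>2)
    + ?c * (\<Sum>i\<in>UNIV. B i i z * \<tau> z + p i z * Q i - R i - H i)"
    by (simp only: sum.distrib sum_distrib_left)
  also have "(\<Sum>i\<in>UNIV. B i i z * \<tau> z + p i z * Q i - R i - H i)
      = \<tau> z * \<tau> z + (\<Sum>i\<in>UNIV. p i z * Q i) - (\<Sum>i\<in>UNIV. R i) - (\<Sum>i\<in>UNIV. H i)"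
    by (simp add: sum.distrib sum_subtractf sum_distrib_right[symmetric] \<tau>_def)
  also have "(\<Sum>i\<in>UNIV. R i) = (\<Sum>i\<in>UNIV. p i z * Q i)"
    unfolding R_def Q_def by (rule third)
  finally show ?thesis
    by (simp add: sum_subtractf sum_distrib_right[symmetric] H_def power2_eq_square)
qed

subsection \<open>Dissipation and defect pointwise\<close>

text \<open>Where \<sigma> > 0, these normalisations give \<rho> X = div V and \<rho> b =
  |p|^(\<beta>-2) (D^2u p . p) / |p|^2, while \<zeta> is |p| d\<eta>/d|p|.\<close>

definition \<rho> :: "(real^'n) \<times> real \<Rightarrow> real" where "\<rho> z = \<sigma> z powr ((\<beta> - 2) / 2)"
definition b :: "(real^'n) \<times> real \<Rightarrow> real" where "b z = (\<Sum>i\<in>UNIV. p i z * v i z) / \<sigma> z"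
definition X :: "(real^'n) \<times> real \<Rightarrow> real" where "X z = \<tau> z + (\<beta> - 2) * b z"
definition y :: "(real^'n) \<times> real \<Rightarrow> real" where "y z = (\<Sum>i\<in>UNIV. M_x i z * p i z) / M z"
definition \<zeta> :: "real \<Rightarrow> (real^'n) \<times> real \<Rightarrow> real" where "\<zeta> L z = 4 * log_ramp L (\<sigma> z) / L"

text \<open>Since every cutoff vanishes at \<sigma> = 0, the estimates need only be proved where
  \<sigma> > 0.\<close>

lemma fields_eq_0:
  assumes "L > 0" "\<sigma> z = 0"
  shows "dissipation L z = 0" "defect L z = 0"
proof -
  have "cutoff L k (\<sigma> z) = 0" "cutoff_deriv L k (\<sigma> z) = 0" for k
    using assms by (auto simp: cutoff_def cutoff_deriv_def)
  then show "dissipation L z = 0" "defect L z = 0"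
    by (simp_all add: dissipation_def defect_def mass_density_def flux_density_def W_def W_x_def W_t_def G_def G_x_def)
qed

lemma \<rho>_pos: "\<sigma> z > 0 \<Longrightarrow> \<rho> z > 0"
  by (simp add: \<rho>_def)

lemma cutoff_at_\<sigma>:
  assumes "\<sigma> z > 0"
  shows "cutoff L ((\<beta> - 2) / 2) (\<sigma> z) = (log_ramp L (\<sigma> z))\<^sup>2 * \<rho> z"
    "2 * cutoff_deriv L ((\<beta> - 2) / 2) (\<sigma> z) = \<rho> z * (\<zeta> L z + (\<beta> - 2) * (log_ramp L (\<sigma> z))\<^sup>2) / \<sigma> z"
    "cutoff L (\<beta> - 2) (\<sigma> z) = (log_ramp L (\<sigma> z))\<^sup>2 * (\<rho> z)\<^sup>2"
    "2 * cutoff_deriv L (\<beta> - 2) (\<sigma> z) = (\<rho> z)\<^sup>2 * (\<zeta> L z + 2 * (\<beta> - 2) * (log_ramp L (\<sigma> z))\<^sup>2) / \<sigma> z"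
proof -
  have "(\<rho> z)\<^sup>2 = \<sigma> z powr (\<beta> - 2)"
    using assms by (simp add: \<rho>_def power2_eq_square flip: powr_add)
  then show "cutoff L ((\<beta> - 2) / 2) (\<sigma> z) = (log_ramp L (\<sigma> z))\<^sup>2 * \<rho> z"
    "2 * cutoff_deriv L ((\<beta> - 2) / 2) (\<sigma> z) = \<rho> z * (\<zeta> L z + (\<beta> - 2) * (log_ramp L (\<sigma> z))\<^sup>2) / \<sigma> z"
    "cutoff L (\<beta> - 2) (\<sigma> z) = (log_ramp L (\<sigma> z))\<^sup>2 * (\<rho> z)\<^sup>2"
    "2 * cutoff_deriv L (\<beta> - 2) (\<sigma> z) = (\<rho> z)\<^sup>2 * (\<zeta> L z + 2 * (\<beta> - 2) * (log_ramp L (\<sigma> z))\<^sup>2) / \<sigma> z"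
    using assms by (simp_all add: cutoff_pos cutoff_deriv_pos \<rho>_def \<zeta>_def)
qed

lemma sum_p_v: "\<sigma> z > 0 \<Longrightarrow> (\<Sum>i\<in>UNIV. p i z * v i z) = \<sigma> z * b z"
  by (simp add: b_def)

lemma sum_M_x_p: "z \<in> S \<Longrightarrow> (\<Sum>i\<in>UNIV. M_x i z * p i z) = M z * y z"
  using M_pos[of z] by (simp add: y_def)

lemma sum_W_x:
  assumes "\<sigma> z > 0"
  shows "(\<Sum>i\<in>UNIV. W_x L i i z) = \<rho> z * ((log_ramp L (\<sigma> z))\<^sup>2 * X z + \<zeta> L z * b z)"
proof -
  let ?d = "cutoff_deriv L ((\<beta> - 2) / 2) (\<sigma> z)" and ?c = "cutoff L ((\<beta> - 2) / 2) (\<sigma> z)"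
  have "(\<Sum>i\<in>UNIV. W_x L i i z) = (2 * ?d) * (\<Sum>i\<in>UNIV. p i z * v i z) + ?c * \<tau> z"
    unfolding W_x_def \<tau>_def sum_distrib_left sum.distrib[symmetric]
    by (intro sum.cong refl) (simp add: algebra_simps)
  also have "\<dots> = \<rho> z * ((log_ramp L (\<sigma> z))\<^sup>2 * X z + \<zeta> L z * b z)"
    unfolding cutoff_at_\<sigma>[OF assms] sum_p_v[OF assms] X_def using assms by (simp add: field_simps)
  finally show ?thesis .
qed

lemma M_t_eq_X:
  assumes "z \<in> S" "\<sigma> z > 0"
  shows "M_t z = M z powr \<gamma> * M z * \<rho> z * X z + (1 + \<gamma>) * M z powr \<gamma> * \<rho> z * (M z * y z)"
  using M_t_eq[OF assms] sum_M_x_p[OF assms(1)] unfolding \<rho>_def X_def b_def by simp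

lemma powr_M:
  assumes "z \<in> S"
  shows "M z powr (r - 1) = M z powr (q + \<gamma> - 1) * M z powr \<gamma>"
    "M z powr r = M z powr (q + \<gamma> - 1) * M z powr \<gamma> * M z"
    "M z powr (q + \<gamma>) = M z powr (q + \<gamma> - 1) * M z"
    "M z powr (q - 1) * M z powr \<gamma> = M z powr (q + \<gamma> - 1)"
proof -
  have "M z powr (e + 1) = M z powr e * M z" for e using M_pos[OF assms] by (simp add: powr_add)
  from this[of "q + \<gamma> - 1"] this[of "r - 1"] show "M z powr (r - 1) = M z powr (q + \<gamma> - 1) * M z powr \<gamma>"
    "M z powr r = M z powr (q + \<gamma> - 1) * M z powr \<gamma> * M z"
    "M z powr (q + \<gamma>) = M z powr (q + \<gamma> - 1) * M z"
    "M z powr (q - 1) * M z powr \<gamma> = M z powr (q + \<gamma> - 1)"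
    by (simp_all add: r_def algebra_simps flip: powr_add)
qed

text \<open>All terms without a derivative of \<eta> cancel by the second equation; what remains is
  -m^(q+\<gamma>) V . D\<eta>, and V . D\<eta> = \<zeta> \<rho> b.\<close>

lemma defect_eq:
  assumes z: "z \<in> S" and pos: "\<sigma> z > 0"
  shows "defect L z = - (M z powr (q + \<gamma>) * \<zeta> L z * (\<rho> z * b z))"
proof -
  let ?A = "M z powr (q + \<gamma> - 1)" and ?\<eta> = "(log_ramp L (\<sigma> z))\<^sup>2"
  have W: "(\<Sum>i\<in>UNIV. M_x i z * W L i z) = ?\<eta> * \<rho> z * (M z * y z)"
    unfolding W_def cutoff_at_\<sigma>[OF pos] sum_M_x_p[OF z, symmetric] sum_distrib_left
    by (intro sum.cong refl) (simp add: algebra_simps)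
  have "flux_density L z = - (?A * (\<Sum>i\<in>UNIV. M_x i z * W L i z))"
    unfolding flux_density_def sum_distrib_left sum_negf[symmetric] by (intro sum.cong refl) (simp add: algebra_simps)
  moreover have "(\<Sum>i\<in>UNIV. (q + \<gamma>) * ?A * M_x i z * W L i z + M z powr (q + \<gamma>) * W_x L i i z)
    = (q + \<gamma>) * ?A * (\<Sum>i\<in>UNIV. M_x i z * W L i z) + M z powr (q + \<gamma>) * (\<Sum>i\<in>UNIV. W_x L i i z)"
    unfolding sum_distrib_left sum.distrib[symmetric] by (intro sum.cong refl) (simp add: algebra_simps)
  moreover have "mass_density L z = ?\<eta> * (M z powr (q - 1) * M z powr \<gamma>) * (M z * \<rho> z * X z + (1 + \<gamma>) * \<rho> z * (M z * y z))"
    using pos by (simp add: mass_density_def cutoff_pos M_t_eq_X[OF z pos] algebra_simps)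
  ultimately show ?thesis
    unfolding defect_def W sum_W_x[OF pos] powr_M[OF z] by (simp add: algebra_simps)
qed

text \<open>Three groups arise: \<eta> times the form that is present without cutoff, \<zeta> times
  the terms from differentiating \<eta>, and the contribution of g', which carries both factors. The
  equations eliminate m_t and p_t, and \<open>sum_G_x\<close> the third derivatives.\<close>

lemma dissipation_eq:
  fixes L :: real
  assumes z: "z \<in> S" and pos: "\<sigma> z > 0"
  defines "\<eta> \<equiv> (log_ramp L (\<sigma> z))\<^sup>2" and "BB \<equiv> \<Sum>i\<in>UNIV. \<Sum>j\<in>UNIV. (B i j z)\<^sup>2"
    and "vv \<equiv> (\<Sum>i\<in>UNIV. (v i z)\<^sup>2) / \<sigma> z" and "ww \<equiv> \<sigma> z * (\<Sum>i\<in>UNIV. (M_x i z)\<^sup>2) / (M z)\<^sup>2"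
  shows "dissipation L z = M z powr r *
     (\<eta> * ((\<rho> z)\<^sup>2 * ((X z)\<^sup>2 - ((\<tau> z)\<^sup>2 - BB + 2 * (\<beta> - 2) * (b z * \<tau> z - vv)) / r + \<gamma> * y z * X z
          - \<gamma> / \<beta> * (ww + (\<beta> - 2) * (y z)\<^sup>2)))
      + \<zeta> L z * ((\<rho> z)\<^sup>2 * (X z * b z - (b z * \<tau> z - vv) / r + \<gamma> * y z * b z - \<gamma> / \<beta> * (y z)\<^sup>2))
      + \<rho> z * deriv g (M z) * M z / (M z powr \<gamma> * \<sigma> z) * (\<eta> * (ww + (\<beta> - 2) * (y z)\<^sup>2) + \<zeta> L z * (y z)\<^sup>2))"
proof -
  let ?A = "M z powr (q + \<gamma> - 1)" and ?P = "M z powr \<gamma>"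
  let ?d = "cutoff_deriv L ((\<beta> - 2) / 2) (\<sigma> z)" and ?c = "cutoff L ((\<beta> - 2) / 2) (\<sigma> z)"
  define E where "E = \<gamma> * ?P * \<rho> z * \<sigma> z / (\<beta> * M z) - deriv g (M z)"
  define mv where "mv = (\<Sum>i\<in>UNIV. M_x i z * v i z)"
  have p_t: "p_t i z = ?P * \<rho> z * v i z + E * M_x i z" for i
    unfolding E_def \<rho>_def by (rule p_t_eq_pos[OF z pos])
  have mm: "(\<Sum>i\<in>UNIV. (M_x i z)\<^sup>2) = (M z)\<^sup>2 * ww / \<sigma> z" using pos M_pos[OF z] by (simp add: ww_def)
  have "(\<Sum>k\<in>UNIV. p k z * p_t k z) = ?P * \<rho> z * (\<Sum>k\<in>UNIV. p k z * v k z) + E * (\<Sum>k\<in>UNIV. M_x k z * p k z)"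
    unfolding p_t sum_distrib_left sum.distrib[symmetric] by (intro sum.cong refl) (simp add: algebra_simps)
  then have pp_t: "(\<Sum>k\<in>UNIV. p k z * p_t k z) = ?P * \<rho> z * (\<sigma> z * b z) + E * (M z * y z)"
    unfolding sum_p_v[OF pos] sum_M_x_p[OF z] .
  have "(\<Sum>i\<in>UNIV. M_x i z * p_t i z) = ?P * \<rho> z * mv + E * (\<Sum>i\<in>UNIV. (M_x i z)\<^sup>2)"
    unfolding p_t mv_def sum_distrib_left sum.distrib[symmetric]
    by (intro sum.cong refl) (simp add: algebra_simps power2_eq_square)
  moreover have "(\<Sum>i\<in>UNIV. M_x i z * W_t L i z) = (2 * ?d) * (\<Sum>k\<in>UNIV. p k z * p_t k z) * (\<Sum>i\<in>UNIV. M_x i z * p i z)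
      + ?c * (\<Sum>i\<in>UNIV. M_x i z * p_t i z)"
    unfolding W_t_def sum_distrib_left[where A = UNIV and f = "\<lambda>i. M_x i z * p i z"] 
      sum_distrib_left[where A = UNIV and f = "\<lambda>i. M_x i z * p_t i z"] sum.distrib[symmetric]
    by (intro sum.cong refl) (simp add: algebra_simps)
  ultimately have MW_t: "(\<Sum>i\<in>UNIV. M_x i z * W_t L i z)
    = \<rho> z * (\<zeta> L z + (\<beta> - 2) * \<eta>) / \<sigma> z * (?P * \<rho> z * (\<sigma> z * b z) + E * (M z * y z)) * (M z * y z)
      + \<eta> * \<rho> z * (?P * \<rho> z * mv + E * ((M z)\<^sup>2 * ww / \<sigma> z))"
    unfolding pp_t sum_M_x_p[OF z] mm cutoff_at_\<sigma>[OF pos] \<eta>_def by simp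
  have MG: "(\<Sum>i\<in>UNIV. M_x i z * G L i z) = \<eta> * (\<rho> z)\<^sup>2 * (M z * y z * \<tau> z - mv)"
    unfolding G_def cutoff_at_\<sigma>[OF pos] sum_M_x_p[OF z, symmetric] mv_def \<eta>_def[symmetric]
      sum_distrib_right sum_subtractf[symmetric] sum_distrib_left
    by (intro sum.cong refl) (simp add: algebra_simps)
  have "(\<Sum>i\<in>UNIV. (v i z)\<^sup>2) = \<sigma> z * vv" using pos by (simp add: vv_def)
  then have Gx: "(\<Sum>i\<in>UNIV. G_x L i z) = (\<rho> z)\<^sup>2 * (\<zeta> L z + 2 * (\<beta> - 2) * \<eta>) / \<sigma> z * (\<sigma> z * b z * \<tau> z - \<sigma> z * vv)
     + \<eta> * (\<rho> z)\<^sup>2 * ((\<tau> z)\<^sup>2 - BB)"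
    unfolding sum_G_x[OF z] cutoff_at_\<sigma>[OF pos] sum_p_v[OF pos] \<eta>_def BB_def by simp
  have "dissipation L z = (\<Sum>i\<in>UNIV. ?A * (M_t z * W_x L i i z) - ?A * (M_x i z * W_t L i z)
      - ?A * ?P * (M_x i z * G L i z) - ?A * ?P * M z * G_x L i z / r)"
    unfolding dissipation_def powr_M[OF z] using r_pos by (intro sum.cong refl) (simp add: field_simps)
  also have "\<dots> = ?A * (M_t z * (\<Sum>i\<in>UNIV. W_x L i i z) - (\<Sum>i\<in>UNIV. M_x i z * W_t L i z))
      - ?A * ?P * (\<Sum>i\<in>UNIV. M_x i z * G L i z) - ?A * ?P * M z * (\<Sum>i\<in>UNIV. G_x L i z) / r"
    by (simp add: sum_subtractf sum_distrib_left sum_divide_distrib right_diff_distrib)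
  also have "\<dots> = M z powr r *
     (\<eta> * ((\<rho> z)\<^sup>2 * ((X z)\<^sup>2 - ((\<tau> z)\<^sup>2 - BB + 2 * (\<beta> - 2) * (b z * \<tau> z - vv)) / r + \<gamma> * y z * X z
          - \<gamma> / \<beta> * (ww + (\<beta> - 2) * (y z)\<^sup>2)))
      + \<zeta> L z * ((\<rho> z)\<^sup>2 * (X z * b z - (b z * \<tau> z - vv) / r + \<gamma> * y z * b z - \<gamma> / \<beta> * (y z)\<^sup>2))
      + \<rho> z * deriv g (M z) * M z / (M z powr \<gamma> * \<sigma> z) * (\<eta> * (ww + (\<beta> - 2) * (y z)\<^sup>2) + \<zeta> L z * (y z)\<^sup>2))"
    unfolding MW_t MG Gx sum_W_x[OF pos] M_t_eq_X[OF z pos] powr_M[OF z] E_def X_def \<eta>_def[symmetric]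
    by (rule dissipation_identity) (use pos M_pos[OF z] beta r_pos in auto)
  finally show ?thesis .
qed

text \<open>The \<eta> group is nonnegative by \<open>congestion_form_nonneg\<close>. So is the g'
  group, because g is nondecreasing and y^2 \<le> ww gives ww + (\<beta> - 2) y^2 \<ge> (\<beta> -
  1) y^2. Only the \<zeta> group is left, estimated by \<open>cutoff_form_ge\<close>.\<close>

lemma dissipation_ge:
  assumes z: "z \<in> S" and pos: "\<sigma> z > 0" and L: "L > 0"
    and H: "\<bar>\<rho> z * X z\<bar> \<le> H" and Y: "\<bar>\<rho> z * y z\<bar> \<le> Y"
  defines "c \<equiv> (\<beta> - 1) / (2 * r)" and "A \<equiv> \<bar>1 - 1 / r\<bar> * H + \<alpha> * (\<beta> - 1) * Y"
  shows "M z powr r * (\<zeta> L z * (c * (\<rho> z * b z)\<^sup>2 - A\<^sup>2 / (4 * c))) \<le> dissipation L z"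
proof -
  define \<eta> BB vv ww where "\<eta> = (log_ramp L (\<sigma> z))\<^sup>2" and "BB = (\<Sum>i\<in>UNIV. \<Sum>j\<in>UNIV. (B i j z)\<^sup>2)"
    and "vv = (\<Sum>i\<in>UNIV. (v i z)\<^sup>2) / \<sigma> z" and "ww = \<sigma> z * (\<Sum>i\<in>UNIV. (M_x i z)\<^sup>2) / (M z)\<^sup>2"
  have gam: "\<gamma> = - (\<alpha> * (\<beta> - 1))" by (simp add: \<gamma>_def algebra_simps)
  have M: "M z > 0" using M_pos z .
  have cs: "(\<Sum>i\<in>UNIV. f i * h i)\<^sup>2 \<le> (\<Sum>i\<in>UNIV. (f i)\<^sup>2) * (\<Sum>i\<in>UNIV. (h i)\<^sup>2)" for f h :: "'n \<Rightarrow> real"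
    by (rule Cauchy_Schwarz_ineq_sum)
  have "(\<sigma> z * b z)\<^sup>2 \<le> \<sigma> z * (\<Sum>i\<in>UNIV. (v i z)\<^sup>2)"
    using cs[of "\<lambda>i. p i z" "\<lambda>i. v i z"] unfolding sum_p_v[OF pos] \<sigma>_def[symmetric] .
  then have bv: "(b z)\<^sup>2 \<le> vv"
    using pos by (simp add: vv_def power2_eq_square field_simps)
  have "(M z * y z)\<^sup>2 \<le> (\<Sum>i\<in>UNIV. (M_x i z)\<^sup>2) * \<sigma> z"
    using cs[of "\<lambda>i. M_x i z" "\<lambda>i. p i z"] unfolding sum_M_x_p[OF z] \<sigma>_def[symmetric] .
  then have yw: "(y z)\<^sup>2 \<le> ww"
    using M by (simp add: ww_def power_mult_distrib field_simps)
  have tr: "(\<tau> z + (\<beta> - 2) * b z)\<^sup>2 / real CARD('n) \<le> BB + 2 * (\<beta> - 2) * vv + (\<beta> - 2)\<^sup>2 * (b z)\<^sup>2"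
    using trace_square_le[of "\<lambda>i j. B i j z" "\<lambda>i. p i z" \<beta>, OF B_sym[OF z]] pos beta
    unfolding \<sigma>_def[symmetric] v_def[symmetric] \<tau>_def[symmetric] BB_def vv_def b_def by simp
  have thr: "\<alpha> * \<beta> / 4 \<le> 1 - (1 - 1 / real CARD('n)) / r"
    using threshold by (simp add: r_def \<gamma>_def algebra_simps)
  let ?Q0 = "(X z)\<^sup>2 - ((\<tau> z)\<^sup>2 - BB + 2 * (\<beta> - 2) * (b z * \<tau> z - vv)) / r + \<gamma> * y z * X z
          - \<gamma> / \<beta> * (ww + (\<beta> - 2) * (y z)\<^sup>2)"
  let ?Q1 = "X z * b z - (b z * \<tau> z - vv) / r + \<gamma> * y z * b z - \<gamma> / \<beta> * (y z)\<^sup>2"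
  have "0 \<le> ?Q0"
    using congestion_form_nonneg[OF alpha beta r_pos tr yw thr] unfolding gam X_def by simp
  then have 0: "0 \<le> \<eta> * ((\<rho> z)\<^sup>2 * ?Q0)" by (simp add: \<eta>_def)
  have "c * (\<rho> z * b z)\<^sup>2 - A\<^sup>2 / (4 * c) \<le> (\<rho> z)\<^sup>2 * ?Q1"
    using cutoff_form_ge[OF alpha beta r_pos \<rho>_pos[OF pos] H[unfolded X_def] Y bv]
    unfolding gam X_def c_def A_def by simp
  moreover have zeta: "0 \<le> \<zeta> L z" using L by (simp add: \<zeta>_def log_ramp_nonneg)
  ultimately have 1: "\<zeta> L z * (c * (\<rho> z * b z)\<^sup>2 - A\<^sup>2 / (4 * c)) \<le> \<zeta> L z * ((\<rho> z)\<^sup>2 * ?Q1)"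
    by (rule mult_left_mono)
  have "0 \<le> ww + (\<beta> - 2) * (y z)\<^sup>2"
  proof -
    have "0 \<le> (\<beta> - 1) * (y z)\<^sup>2" using beta by simp
    then show ?thesis using yw by (simp add: algebra_simps)
  qed
  then have 2: "0 \<le> \<rho> z * deriv g (M z) * M z / (M z powr \<gamma> * \<sigma> z) * (\<eta> * (ww + (\<beta> - 2) * (y z)\<^sup>2) + \<zeta> L z * (y z)\<^sup>2)"
    using deriv_g_nonneg[OF M] \<rho>_pos[OF pos] M pos zeta by (simp add: \<eta>_def)
  show ?thesis
    unfolding dissipation_eq[OF z pos] \<eta>_def[symmetric] BB_def[symmetric] vv_def[symmetric] ww_def[symmetric]
    by (rule mult_left_mono) (use 0 1 2 in linarith, simp)
qed

text \<open>With t = \<rho> b, the size of the defect is m^(q+\<gamma>) \<zeta> |t|. Young's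
  inequality gives |t| \<le> \<delta> t^2 + 1/\<delta>; the square is controlled by the dissipation,
  and the remaining terms carry \<zeta> \<le> Z / L.\<close>

lemma defect_le_dissipation:
  assumes z: "z \<in> S" and pos: "\<sigma> z > 0" and L: "L > 0" and \<delta>: "0 < \<delta>" "\<delta> \<le> 1"
    and H: "\<bar>\<rho> z * X z\<bar> \<le> H" and Y: "\<bar>\<rho> z * y z\<bar> \<le> Y" and Z: "\<zeta> L z \<le> Z / L"
    and M0: "M z powr (- \<gamma>) \<le> M0" and M1: "M z powr (q + \<gamma>) \<le> M1" and M2: "M z powr r \<le> M2"
  defines "c \<equiv> (\<beta> - 1) / (2 * r)" and "A \<equiv> \<bar>1 - 1 / r\<bar> * H + \<alpha> * (\<beta> - 1) * Y"
  shows "\<bar>defect L z\<bar> \<le> M0 / c * \<delta> * dissipation L z + (M0 / c * (M2 * Z * (A\<^sup>2 / (4 * c))) + M1 * Z) / (\<delta> * L)"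
proof -
  let ?t = "\<rho> z * b z" and ?K = "A\<^sup>2 / (4 * c)"
  have c: "c > 0" using beta r_pos by (simp add: c_def)
  have K: "?K \<ge> 0" using c by simp
  have zeta: "0 \<le> \<zeta> L z" using L by (simp add: \<zeta>_def log_ramp_nonneg)
  have M: "M z > 0" using M_pos z .
  have M0': "M0 \<ge> 0" by (rule order_trans[OF _ M0]) simp
  have M1': "M1 \<ge> 0" by (rule order_trans[OF _ M1]) simp
  have M2': "M2 \<ge> 0" by (rule order_trans[OF _ M2]) simp
  have Z': "Z / L \<ge> 0" using Z zeta by linarith
  \<comment> \<open>This trades the weight of the defect for the weight m^r of the
    dissipation.\<close>
  have pw: "M z powr (q + \<gamma>) = M z powr (- \<gamma>) * M z powr r"
    by (simp add: r_def add.commute flip: powr_add)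
  have D: "M z powr r * \<zeta> L z * (c * ?t\<^sup>2) \<le> dissipation L z + M z powr r * \<zeta> L z * ?K"
    using dissipation_ge[OF z pos L H Y] unfolding c_def[symmetric] A_def[symmetric] by (simp add: algebra_simps)
  have "0 \<le> \<delta> * (\<bar>?t\<bar> - 1 / (2 * \<delta>))\<^sup>2" using \<delta> by simp
  also have "\<dots> = \<delta> * ?t\<^sup>2 - \<bar>?t\<bar> + 1 / (4 * \<delta>)"
    using \<delta> by (simp add: power2_diff power_divide field_simps power2_eq_square)
  finally have t: "\<bar>?t\<bar> \<le> \<delta> * ?t\<^sup>2 + 1 / \<delta>"
    using \<delta> by (simp add: field_simps)
  have "\<bar>defect L z\<bar> = M z powr (q + \<gamma>) * \<zeta> L z * \<bar>?t\<bar>"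
    unfolding defect_eq[OF z pos] using zeta by (simp add: abs_mult)
  also have "\<dots> \<le> M z powr (q + \<gamma>) * \<zeta> L z * (\<delta> * ?t\<^sup>2 + 1 / \<delta>)"
    by (rule mult_left_mono[OF t]) (use zeta in simp)
  also have "\<dots> = M z powr (- \<gamma>) * (\<delta> / c) * (M z powr r * \<zeta> L z * (c * ?t\<^sup>2)) + M z powr (q + \<gamma>) * \<zeta> L z * (1 / \<delta>)"
    unfolding pw using c by (simp add: field_simps)
  \<comment> \<open>The dissipation alone need not be nonnegative, so m^(-\<gamma>) is bounded by
    \<open>M0\<close> while its cofactor is still the nonnegative square.\<close>
  also have "\<dots> \<le> M0 * (\<delta> / c) * (dissipation L z + M2 * (Z / L) * ?K) + M1 * (Z / L) * (1 / \<delta>)"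
  proof (intro add_mono mult_mono)
    show "M z powr r * \<zeta> L z * (c * ?t\<^sup>2) \<le> dissipation L z + M2 * (Z / L) * ?K"
    proof -
      have "M z powr r * \<zeta> L z * ?K \<le> M2 * (Z / L) * ?K"
        using M2 M2' Z zeta K by (intro mult_right_mono mult_mono) auto
      then show ?thesis using D by linarith
    qed
    show "0 \<le> M1 * (Z / L)" by (rule mult_nonneg_nonneg[OF M1' Z'])
  qed (use M0 M1 M1' Z zeta M0' c \<delta> in auto)
  also have "\<dots> = M0 / c * \<delta> * dissipation L z + (M0 / c * (M2 * Z * ?K) * \<delta> * \<delta> + M1 * Z) / (\<delta> * L)"
    using \<delta> L c by (simp add: field_simps)
  also have "\<dots> \<le> M0 / c * \<delta> * dissipation L z + (M0 / c * (M2 * Z * ?K) + M1 * Z) / (\<delta> * L)"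
  proof -
    have Z'': "Z \<ge> 0" using Z' L by (simp add: zero_le_divide_iff)
    \<comment> \<open>\<open>\<delta> \<le> 1\<close> lets both error terms share the denominator
      \<open>\<delta> * L\<close>.\<close>
    have "M0 / c * (M2 * Z * ?K) * (\<delta> * \<delta>) \<le> M0 / c * (M2 * Z * ?K) * 1"
      using \<delta> M0' M2' Z'' K c by (intro mult_left_mono mult_le_one) auto
    then show ?thesis using \<delta> L by (intro add_left_mono divide_right_mono) (auto simp: mult.assoc)
  qed
  finally show ?thesis .
qed

section \<open>Bounds uniform on compact time intervals\<close>

lemma bounded_on_slab:
  fixes F :: "(real^'n) \<times> real \<Rightarrow> real"
  assumes "continuous_on S F" "0 < t1" "t2 < T"
  obtains C where "C > 0" "\<And>x t. x \<in> cbox 0 One \<Longrightarrow> t \<in> {t1..t2} \<Longrightarrow> \<bar>F (x, t)\<bar> \<le> C"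
proof -
  have "continuous_on (cbox 0 One \<times> {t1..t2}) F"
    by (rule continuous_on_subset[OF assms(1)]) (use assms in \<open>auto simp: S_def\<close>)
  then have "compact (F ` (cbox 0 One \<times> {t1..t2}))"
    by (intro compact_continuous_image compact_Times compact_cbox compact_Icc)
  then have "bounded (F ` (cbox 0 One \<times> {t1..t2}))" by (rule compact_imp_bounded)
  then obtain C where C: "C > 0" "\<forall>w \<in> F ` (cbox 0 One \<times> {t1..t2}). norm w \<le> C"
    unfolding bounded_pos by blast
  show thesis by (rule that[OF C(1)]) (use C(2) in auto)
qed

text \<open>For \<beta> < 2 the factor \<rho> blows up as p tends to 0; its product with p, a
  component of V, still has size at most |p|^(\<beta>-1).\<close>

lemma \<rho>_p_le:
  assumes "\<sigma> z > 0" "\<sigma> z \<le> s"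
  shows "\<rho> z * \<bar>p i z\<bar> \<le> s powr ((\<beta> - 1) / 2)"
proof -
  have "(p i z)\<^sup>2 \<le> \<sigma> z" unfolding \<sigma>_def by (intro member_le_sum) auto
  then have "\<bar>p i z\<bar> \<le> \<sigma> z powr (1 / 2)"
    using assms by (simp add: powr_half_sqrt real_le_rsqrt)
  then have "\<rho> z * \<bar>p i z\<bar> \<le> \<rho> z * \<sigma> z powr (1 / 2)"
    using \<rho>_pos[OF assms(1)] by (intro mult_left_mono) auto
  also have "\<dots> = \<sigma> z powr ((\<beta> - 1) / 2)"
    by (simp add: \<rho>_def flip: powr_add) (simp add: diff_divide_distrib)
  also have "\<dots> \<le> s powr ((\<beta> - 1) / 2)" using assms beta by (intro powr_mono2) auto
  finally show ?thesis .
qed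

text \<open>The constants must depend neither on L nor on \<delta>. Compactness bounds the powers
  and first derivatives of m; \<rho> y is then bounded because V is, and \<rho> X = div V because
  the second equation can be solved for it.\<close>

lemma defect_bound:
  assumes t: "0 < t1" "t2 < T"
  obtains C1 C2 where "C1 > 0" "C2 \<ge> 0"
    "\<And>L \<delta> x t. L \<ge> 1 \<Longrightarrow> 0 < \<delta> \<Longrightarrow> \<delta> \<le> 1 \<Longrightarrow> x \<in> cbox 0 One \<Longrightarrow> t \<in> {t1..t2} \<Longrightarrow>
       \<bar>defect L (x, t)\<bar> \<le> C1 * \<delta> * dissipation L (x, t) + C2 / (\<delta> * L)"
proof -
  note bd = bounded_on_slab[OF _ t]
  obtain s0 where s0: "s0 > 0" "\<And>x t. x \<in> cbox 0 One \<Longrightarrow> t \<in> {t1..t2} \<Longrightarrow> \<bar>\<sigma> (x, t)\<bar> \<le> s0"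
    using bd[OF continuous_\<sigma>] by blast
  have cont_y: "continuous_on S (\<lambda>z. (\<Sum>i\<in>UNIV. \<bar>M_x i z\<bar>) * M z powr - 1)"
    and cont_h: "continuous_on S (\<lambda>z. M_t z * M z powr (- (1 + \<gamma>)))"
    by (intro continuous_all continuous_on_rabs)+
  obtain y0 where y0: "y0 > 0" "\<And>x t. x \<in> cbox 0 One \<Longrightarrow> t \<in> {t1..t2} \<Longrightarrow>
      \<bar>(\<Sum>i\<in>UNIV. \<bar>M_x i (x, t)\<bar>) * M (x, t) powr - 1\<bar> \<le> y0"
    using bd[OF cont_y] by blast
  obtain h0 where h0: "h0 > 0" "\<And>x t. x \<in> cbox 0 One \<Longrightarrow> t \<in> {t1..t2} \<Longrightarrow> \<bar>M_t (x, t) * M (x, t) powr (- (1 + \<gamma>))\<bar> \<le> h0"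
    using bd[OF cont_h] by blast
  obtain M0 where M0: "M0 > 0" "\<And>x t. x \<in> cbox 0 One \<Longrightarrow> t \<in> {t1..t2} \<Longrightarrow> \<bar>M (x, t) powr (- \<gamma>)\<bar> \<le> M0"
    using bd[OF continuous_M_powr] by blast
  obtain M1 where M1: "M1 > 0" "\<And>x t. x \<in> cbox 0 One \<Longrightarrow> t \<in> {t1..t2} \<Longrightarrow> \<bar>M (x, t) powr (q + \<gamma>)\<bar> \<le> M1"
    using bd[OF continuous_M_powr] by blast
  obtain M2 where M2: "M2 > 0" "\<And>x t. x \<in> cbox 0 One \<Longrightarrow> t \<in> {t1..t2} \<Longrightarrow> \<bar>M (x, t) powr r\<bar> \<le> M2"
    using bd[OF continuous_M_powr] by blast
  \<comment> \<open>Adding 1 ensures \<open>1 \<le> s\<close>, as \<open>log_ramp_le\<close>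
    demands.\<close>
  define s where "s = s0 + 1"
  define Y where "Y = s powr ((\<beta> - 1) / 2) * y0"
  define H where "H = h0 + \<bar>1 + \<gamma>\<bar> * Y"
  define Z where "Z = 4 * (1 + ln s)"
  define c where "c = (\<beta> - 1) / (2 * r)"
  define A where "A = \<bar>1 - 1 / r\<bar> * H + \<alpha> * (\<beta> - 1) * Y"
  define C2 where "C2 = M0 / c * (M2 * Z * (A\<^sup>2 / (4 * c))) + M1 * Z"
  have s: "1 \<le> s" using s0 by (simp add: s_def)
  have c: "c > 0" using beta r_pos by (simp add: c_def)
  have Z: "Z \<ge> 0" using s by (simp add: Z_def)
  have C2: "C2 \<ge> 0" unfolding C2_def using M0(1) M1(1) M2(1) Z c by simp
  show thesis
  proof (rule that[of "M0 / c" C2])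
    show "M0 / c > 0" using M0 c by simp
    fix L \<delta> t :: real and x :: "real^'n"
    assume L: "1 \<le> L" and \<delta>: "0 < \<delta>" "\<delta> \<le> 1" and xt: "x \<in> cbox 0 One" "t \<in> {t1..t2}"
    let ?z = "(x, t)"
    have z: "?z \<in> S" using xt t by (simp add: S_def)
    show "\<bar>defect L ?z\<bar> \<le> M0 / c * \<delta> * dissipation L ?z + C2 / (\<delta> * L)"
    proof (cases "\<sigma> ?z = 0")
      case True
      then show ?thesis using fields_eq_0[of L ?z] L \<delta> C2 by simp
    next
      case False
      then have pos: "\<sigma> ?z > 0" using \<sigma>_nonneg[of ?z] by simp
      have le: "\<sigma> ?z \<le> s" using s0(2)[OF xt] by (simp add: s_def)
      have M: "M ?z > 0" using M_pos z .
      have Mi: "M ?z powr - 1 = 1 / M ?z" using M by (simp add: powr_minus_divide)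
      have num: "\<bar>\<Sum>i\<in>UNIV. \<rho> ?z * p i ?z * M_x i ?z\<bar> \<le> (\<Sum>i\<in>UNIV. s powr ((\<beta> - 1) / 2) * \<bar>M_x i ?z\<bar>)"
      proof (rule order_trans[OF sum_abs sum_mono])
        fix i
        show "\<bar>\<rho> ?z * p i ?z * M_x i ?z\<bar> \<le> s powr ((\<beta> - 1) / 2) * \<bar>M_x i ?z\<bar>"
          using \<rho>_p_le[OF pos le, of i] \<rho>_pos[OF pos] by (simp add: abs_mult mult_right_mono)
      qed
      have "\<bar>\<rho> ?z * y ?z\<bar> = \<bar>\<Sum>i\<in>UNIV. \<rho> ?z * p i ?z * M_x i ?z\<bar> * M ?z powr - 1"
        using M by (simp add: y_def Mi abs_mult sum_distrib_left mult.assoc mult.commute[of "p _ ?z"])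
      also have "\<dots> \<le> (\<Sum>i\<in>UNIV. s powr ((\<beta> - 1) / 2) * \<bar>M_x i ?z\<bar>) * M ?z powr - 1"
        by (rule mult_right_mono[OF num]) simp
      also have "\<dots> = s powr ((\<beta> - 1) / 2) * ((\<Sum>i\<in>UNIV. \<bar>M_x i ?z\<bar>) * M ?z powr - 1)"
        by (simp add: sum_distrib_left)
      also have "\<dots> \<le> Y" unfolding Y_def using y0(2)[OF xt] by (intro mult_left_mono) auto
      finally have Y: "\<bar>\<rho> ?z * y ?z\<bar> \<le> Y" .
      have "\<rho> ?z * X ?z = M_t ?z * M ?z powr (- (1 + \<gamma>)) - (1 + \<gamma>) * (\<rho> ?z * y ?z)"
      proof -
        let ?Q = "M ?z powr (- (1 + \<gamma>))"
        have "M ?z powr \<gamma> * M ?z * ?Q = 1"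
          using M by (simp only: powr_minus_divide) (simp add: powr_add)
        moreover have "M_t ?z * ?Q = (M ?z powr \<gamma> * M ?z * ?Q) * (\<rho> ?z * X ?z + (1 + \<gamma>) * (\<rho> ?z * y ?z))"
          unfolding M_t_eq_X[OF z pos] by (simp only: algebra_simps)
        ultimately show ?thesis by simp
      qed
      also have "\<bar>\<dots>\<bar> \<le> \<bar>M_t ?z * M ?z powr (- (1 + \<gamma>))\<bar> + \<bar>1 + \<gamma>\<bar> * \<bar>\<rho> ?z * y ?z\<bar>"
        unfolding abs_mult[of "1 + \<gamma>", symmetric] by (rule abs_triangle_ineq4)
      also have "\<dots> \<le> H" unfolding H_def using h0(2)[OF xt] Y by (intro add_mono mult_left_mono) auto
      finally have H: "\<bar>\<rho> ?z * X ?z\<bar> \<le> H" .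
      have "\<zeta> L ?z \<le> Z / L"
        unfolding \<zeta>_def Z_def using log_ramp_le[OF L pos le s] L by (intro divide_right_mono) auto
      from defect_le_dissipation[OF z pos _ \<delta> H Y this] M0(2)[OF xt] M1(2)[OF xt] M2(2)[OF xt] L
      show ?thesis unfolding C2_def c_def A_def by simp
    qed
  qed (rule C2)
qed

text \<open>The unit cube has measure 1, so integrating \<open>defect_bound\<close> leaves its
  constants unchanged.\<close>

lemma integral_defect_bound:
  assumes t: "0 < t1" "t2 < T"
  obtains C1 C2 where "C1 > 0" "C2 \<ge> 0"
    "\<And>L \<delta> t. L \<ge> 1 \<Longrightarrow> 0 < \<delta> \<Longrightarrow> \<delta> \<le> 1 \<Longrightarrow> t \<in> {t1..t2} \<Longrightarrow>
       \<bar>torus_integral (\<lambda>x. mass_density L (x, t)) - (q - 1) * torus_integral (\<lambda>x. flux_density L (x, t))\<bar>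
       \<le> C1 * \<delta> * torus_integral (\<lambda>x. dissipation L (x, t)) + C2 / (\<delta> * L)"
proof -
  obtain C1 C2 where C: "C1 > 0" "C2 \<ge> 0"
    "\<And>L \<delta> x t. L \<ge> 1 \<Longrightarrow> 0 < \<delta> \<Longrightarrow> \<delta> \<le> 1 \<Longrightarrow> x \<in> cbox 0 One \<Longrightarrow> t \<in> {t1..t2} \<Longrightarrow>
       \<bar>defect L (x, t)\<bar> \<le> C1 * \<delta> * dissipation L (x, t) + C2 / (\<delta> * L)"
    using defect_bound[OF t] by metis
  show thesis
  proof (rule that[OF C(1,2)])
    fix L \<delta> s :: real assume L: "1 \<le> L" and \<delta>: "0 < \<delta>" "\<delta> \<le> 1" and s: "s \<in> {t1..t2}"
    have s': "s \<in> {0<..<T}" and L': "L > 0" using s t L by auto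
    note diss = integrable_slice[OF continuous_dissipation[OF L'] s']
    have diss': "(\<lambda>x. C1 * \<delta> * dissipation L (x, s)) integrable_on cbox 0 One"
      using integrable_on_cmult_left[OF diss, of "C1 * \<delta>"] by simp
    have "\<bar>torus_integral (\<lambda>x. defect L (x, s))\<bar>
        \<le> integral (cbox 0 One) (\<lambda>x. C1 * \<delta> * dissipation L (x, s) + C2 / (\<delta> * L))"
      unfolding torus_integral_def real_norm_def[symmetric]
      by (rule integral_norm_bound_integral)
        (auto intro!: integrable_slice[OF continuous_defect[OF L'] s'] integrable_add diss'
          C(3)[OF L \<delta> _ s])
    also have "\<dots> = C1 * \<delta> * torus_integral (\<lambda>x. dissipation L (x, s)) + C2 / (\<delta> * L)"
      unfolding torus_integral_def
      by (subst integral_add) (auto intro!: diss')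
    finally show "\<bar>torus_integral (\<lambda>x. mass_density L (x, s)) - (q - 1) * torus_integral (\<lambda>x. flux_density L (x, s))\<bar>
       \<le> C1 * \<delta> * torus_integral (\<lambda>x. dissipation L (x, s)) + C2 / (\<delta> * L)"
      unfolding torus_integral_defect[OF L' s'] .
  qed
qed

text \<open>At a zero of the gradient that is a limit of zeros along every coordinate direction, the
  difference quotients of the flux vanish along sequences, so its pointwise divergence is \<open>0\<close>.\<close>

lemma negligible_M_t_nonzero:
  assumes t: "t \<in> {0<..<T}"
  shows "negligible {x. \<sigma> (x, t) = 0 \<and> M_t (x, t) \<noteq> 0}"
proof -
  let ?Z = "{x. \<sigma> (x, t) = 0}"
  let ?E = "\<lambda>i k. {x \<in> ?Z. \<forall>s. 0 < \<bar>s\<bar> \<and> \<bar>s\<bar> < inverse (real (Suc k)) \<longrightarrow> x + s *\<^sub>R axis i 1 \<notin> ?Z}"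
  have S: "(x, t) \<in> S" for x using t by (simp add: S_def)
  have "continuous_on UNIV (\<lambda>x. \<sigma> (x, t))"
    by (rule continuous_on_compose2[OF continuous_\<sigma>]) (auto intro!: continuous_intros S)
  then have "closed ?Z" by (intro closed_Collect_eq continuous_on_const)
  then have "negligible (?E i k)" for i k
    by (rule negligible_isolated_along) simp
  then have neg: "negligible (\<Union>i. \<Union>k. ?E i k)"
    by (intro negligible_Union) (auto intro: negligible_Union_nat)
  have key: "M_t (x, t) = 0" if x: "x \<in> ?Z" "x \<notin> (\<Union>i. \<Union>k. ?E i k)" for x
  proof -
    obtain F' where F': "\<And>i. has_pd (\<lambda>z. M z powr (1 + \<gamma>) * \<sigma> z powr ((\<beta> - 2) / 2) * p i z) (dx i) (F' i) (x, t)"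
      and M_t: "M_t (x, t) = (\<Sum>i\<in>UNIV. F' i)"
      using divergence_eq[OF S] by blast
    have "F' i = 0" for i
    proof -
      let ?f = "\<lambda>s. M (x + s *\<^sub>R axis i 1, t) powr (1 + \<gamma>) * \<sigma> (x + s *\<^sub>R axis i 1, t) powr ((\<beta> - 2) / 2) * p i (x + s *\<^sub>R axis i 1, t)"
      have "\<forall>k. \<exists>s. 0 < \<bar>s\<bar> \<and> \<bar>s\<bar> < inverse (real (Suc k)) \<and> x + s *\<^sub>R axis i 1 \<in> ?Z"
        using x by blast
      then obtain s where s: "\<And>k. 0 < \<bar>s k\<bar>" "\<And>k. \<bar>s k\<bar> < inverse (real (Suc k))" "\<And>k. x + s k *\<^sub>R axis i 1 \<in> ?Z"
        by metis
      have "s \<longlonglongrightarrow> 0"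
        by (rule tendsto_rabs_zero_cancel, rule tendsto_sandwich[OF _ _ tendsto_const LIMSEQ_inverse_real_of_nat])
          (use s(2) in \<open>auto intro!: always_eventually less_imp_le\<close>)
      then have lim: "filterlim s (at 0) sequentially"
        using s(1) unfolding filterlim_at by (simp add: always_eventually)
      have "((\<lambda>h. (?f h - ?f 0) / h) \<longlongrightarrow> F' i) (at 0)"
        using F'[of i] unfolding has_pd_def DERIV_def by simp
      from filterlim_compose[OF this lim]
      have "(\<lambda>k. (?f (s k) - ?f 0) / s k) \<longlonglongrightarrow> F' i" .
      moreover have "(\<lambda>k. (?f (s k) - ?f 0) / s k) = (\<lambda>k. 0)"
        using s(3) x(1) by (auto simp: p_eq_0)
      ultimately show ?thesis by (simp add: LIMSEQ_const_iff)
    qed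
    then show ?thesis using M_t by simp
  qed
  show ?thesis
    by (rule negligible_subset[OF neg], rule subsetI, rule ccontr) (use key in blast)
qed

subsection \<open>Removing the truncation\<close>

definition flux :: "real \<Rightarrow> real \<Rightarrow> real" where
  "flux L t = torus_integral (\<lambda>x. flux_density L (x, t))"

definition mass_rate :: "real \<Rightarrow> real \<Rightarrow> real" where
  "mass_rate L t = torus_integral (\<lambda>x. mass_density L (x, t))"

text \<open>This is the integral I itself, with V in place of W.\<close>

definition flux_limit :: "real \<Rightarrow> real" where
  "flux_limit t = torus_integral (\<lambda>x. \<Sum>i\<in>UNIV. - (M (x, t) powr (q + \<gamma> - 1) * M_x i (x, t) * (\<rho> (x, t) * p i (x, t))))"

text \<open>\<open>q\<close> times this is the time derivative of the integral of m^q.\<close>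

definition rate :: "real \<Rightarrow> real" where
  "rate t = torus_integral (\<lambda>x. M (x, t) powr (q - 1) * M_t (x, t))"

text \<open>Dominating constants for L \<rightarrow> \<infinity>: where \<sigma> \<le> s and s \<ge>
  1, the factor \<eta> is at most (1 + ln s)^2 for all L \<ge> 1.\<close>

lemma densities_bounded:
  assumes t: "0 < t1" "t2 < T"
  obtains C where "\<And>L x t. L \<ge> 1 \<Longrightarrow> x \<in> cbox 0 One \<Longrightarrow> t \<in> {t1..t2} \<Longrightarrow>
    \<bar>flux_density L (x, t)\<bar> \<le> C \<and> \<bar>mass_density L (x, t)\<bar> \<le> C"
proof -
  note bd = bounded_on_slab[OF _ t]
  have cont: "continuous_on S (\<lambda>z. \<Sum>i\<in>UNIV. M z powr (q + \<gamma> - 1) * \<bar>M_x i z\<bar>)"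
    "continuous_on S (\<lambda>z. M z powr (q - 1) * \<bar>M_t z\<bar>)"
    by (intro continuous_all continuous_on_rabs)+
  obtain s0 where s0: "s0 > 0" "\<And>x t. x \<in> cbox 0 One \<Longrightarrow> t \<in> {t1..t2} \<Longrightarrow> \<bar>\<sigma> (x, t)\<bar> \<le> s0"
    using bd[OF continuous_\<sigma>] by blast
  obtain f0 where f0: "f0 > 0" "\<And>x t. x \<in> cbox 0 One \<Longrightarrow> t \<in> {t1..t2} \<Longrightarrow>
      \<bar>\<Sum>i\<in>UNIV. M (x, t) powr (q + \<gamma> - 1) * \<bar>M_x i (x, t)\<bar>\<bar> \<le> f0"
    using bd[OF cont(1)] by blast
  obtain m0 where m0: "m0 > 0" "\<And>x t. x \<in> cbox 0 One \<Longrightarrow> t \<in> {t1..t2} \<Longrightarrow> \<bar>M (x, t) powr (q - 1) * \<bar>M_t (x, t)\<bar>\<bar> \<le> m0"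
    using bd[OF cont(2)] by blast
  define s where "s = s0 + 1"
  define E where "E = (1 + ln s)\<^sup>2"
  define Q where "Q = s powr ((\<beta> - 1) / 2)"
  have s: "1 \<le> s" using s0 by (simp add: s_def)
  have E: "E \<ge> 0" and Q: "Q \<ge> 0" by (simp_all add: E_def Q_def)
  show thesis
  proof (rule that)
    fix L t :: real and x :: "real^'n"
    assume L: "1 \<le> L" and xt: "x \<in> cbox 0 One" "t \<in> {t1..t2}"
    let ?z = "(x, t)"
    have f0': "0 \<le> f0 * (E * Q)" "0 \<le> E * m0" using E Q f0 m0 by auto
    show "\<bar>flux_density L ?z\<bar> \<le> f0 * (E * Q) + E * m0 \<and> \<bar>mass_density L ?z\<bar> \<le> f0 * (E * Q) + E * m0"
    proof (cases "\<sigma> ?z = 0")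
      case True
      then show ?thesis using f0' by (simp add: flux_density_def mass_density_def W_def cutoff_def)
    next
      case False
      then have pos: "\<sigma> ?z > 0" using \<sigma>_nonneg[of ?z] by simp
      have le: "\<sigma> ?z \<le> s" using s0(2)[OF xt] by (simp add: s_def)
      have ramp: "(log_ramp L (\<sigma> ?z))\<^sup>2 \<le> E"
        unfolding E_def by (intro power_mono log_ramp_le L pos le s log_ramp_nonneg)
      have W: "\<bar>W L i ?z\<bar> \<le> E * Q" for i
      proof -
        have "\<bar>W L i ?z\<bar> = (log_ramp L (\<sigma> ?z))\<^sup>2 * (\<rho> ?z * \<bar>p i ?z\<bar>)"
          using \<rho>_pos[OF pos] by (simp add: W_def cutoff_at_\<sigma>[OF pos] abs_mult)
        also have "\<dots> \<le> E * Q"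
          unfolding Q_def by (intro mult_mono ramp \<rho>_p_le pos le E) (use \<rho>_pos[OF pos] in auto)
        finally show ?thesis .
      qed
      have "\<bar>flux_density L ?z\<bar> \<le> (\<Sum>i\<in>UNIV. M ?z powr (q + \<gamma> - 1) * \<bar>M_x i ?z\<bar> * (E * Q))"
        unfolding flux_density_def
        by (rule order_trans[OF sum_abs sum_mono]) (auto simp: abs_mult intro!: mult_left_mono W)
      also have "\<dots> = (\<Sum>i\<in>UNIV. M ?z powr (q + \<gamma> - 1) * \<bar>M_x i ?z\<bar>) * (E * Q)"
        by (simp only: sum_distrib_right)
      also have "\<dots> \<le> f0 * (E * Q)"
        using f0(2)[OF xt] E Q by (intro mult_right_mono) auto
      finally have 1: "\<bar>flux_density L ?z\<bar> \<le> f0 * (E * Q)" .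
      have "\<bar>mass_density L ?z\<bar> = (log_ramp L (\<sigma> ?z))\<^sup>2 * (M ?z powr (q - 1) * \<bar>M_t ?z\<bar>)"
        using pos by (simp add: mass_density_def cutoff_pos abs_mult)
      also have "\<dots> \<le> E * m0"
        using m0(2)[OF xt] by (intro mult_mono ramp E) auto
      finally show ?thesis using 1 f0' by linarith
    qed
  qed
qed

lemma integral_bounded_cube:
  assumes "continuous_on S F" "t \<in> {0<..<T}" "\<And>x. x \<in> cbox 0 One \<Longrightarrow> \<bar>F (x, t)\<bar> \<le> C"
  shows "\<bar>torus_integral (\<lambda>x. F (x, t))\<bar> \<le> C"
proof -
  have "norm (integral (cbox 0 One) (\<lambda>x. F (x, t))) \<le> integral (cbox 0 One) (\<lambda>x::real^'n. C)"
    by (rule integral_norm_bound_integral) (auto intro!: integrable_slice assms)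
  then show ?thesis by (simp add: torus_integral_def)
qed

text \<open>Dominated convergence along L = n + 1, which stays in the range L \<ge> 1 of the bounds;
  at zeros of p both the fields and the limit are 0.\<close>

lemma flux_tendsto:
  assumes t: "t \<in> {0<..<T}"
  shows "(\<lambda>n. flux (real (Suc n)) t) \<longlonglongrightarrow> flux_limit t"
proof -
  obtain C where C: "\<And>L x s. L \<ge> 1 \<Longrightarrow> x \<in> cbox 0 One \<Longrightarrow> s \<in> {t..t} \<Longrightarrow>
    \<bar>flux_density L (x, s)\<bar> \<le> C \<and> \<bar>mass_density L (x, s)\<bar> \<le> C"
    using densities_bounded[of t t] t by auto
  show ?thesis
    unfolding flux_def flux_limit_def torus_integral_def
  proof (rule dominated_convergence(2)[where h = "\<lambda>_. C"])
    fix n x assume x: "x \<in> cbox 0 (One :: real^'n)"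
    show "norm (flux_density (real (Suc n)) (x, t)) \<le> C" using C[OF _ x, of "real (Suc n)" t] by simp
  next
    fix x :: "real^'n"
    have "(\<lambda>n. W (real (Suc n)) i (x, t)) \<longlonglongrightarrow> \<rho> (x, t) * p i (x, t)" for i
    proof (cases "\<sigma> (x, t) = 0")
      case True
      then show ?thesis by (simp add: W_def p_eq_0)
    next
      case False
      then have "\<sigma> (x, t) > 0" using \<sigma>_nonneg[of "(x, t)"] by simp
      then show ?thesis unfolding W_def \<rho>_def by (intro tendsto_mult cutoff_tendsto tendsto_const)
    qed
    then show "(\<lambda>n. flux_density (real (Suc n)) (x, t)) \<longlonglongrightarrow>
      (\<Sum>i\<in>UNIV. - (M (x, t) powr (q + \<gamma> - 1) * M_x i (x, t) * (\<rho> (x, t) * p i (x, t))))"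
      unfolding flux_density_def by (intro tendsto_sum tendsto_minus tendsto_mult tendsto_const)
  qed (auto intro!: integrable_slice continuous_flux_density t)
qed

text \<open>The set where Du = 0 may have positive measure, and there the truncated densities are 0.
  The limit is still \<open>rate\<close>, because m_t vanishes almost everywhere on that
  set.\<close>

lemma mass_rate_tendsto:
  assumes t: "t \<in> {0<..<T}"
  shows "(\<lambda>n. mass_rate (real (Suc n)) t) \<longlonglongrightarrow> rate t"
proof -
  obtain C where C: "\<And>L x s. L \<ge> 1 \<Longrightarrow> x \<in> cbox 0 One \<Longrightarrow> s \<in> {t..t} \<Longrightarrow>
    \<bar>flux_density L (x, s)\<bar> \<le> C \<and> \<bar>mass_density L (x, s)\<bar> \<le> C"
    using densities_bounded[of t t] t by auto
  let ?h = "\<lambda>x. if \<sigma> (x, t) = 0 then 0 else M (x, t) powr (q - 1) * M_t (x, t)"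
  have "(\<lambda>n. mass_rate (real (Suc n)) t) \<longlonglongrightarrow> integral (cbox 0 One) ?h"
    unfolding mass_rate_def torus_integral_def
  proof (rule dominated_convergence(2)[where h = "\<lambda>_. C"])
    fix n x assume x: "x \<in> cbox 0 (One :: real^'n)"
    show "norm (mass_density (real (Suc n)) (x, t)) \<le> C" using C[OF _ x, of "real (Suc n)" t] by simp
  next
    fix x :: "real^'n"
    show "(\<lambda>n. mass_density (real (Suc n)) (x, t)) \<longlonglongrightarrow> ?h x"
    proof (cases "\<sigma> (x, t) = 0")
      case True
      then show ?thesis by (simp add: mass_density_def cutoff_def)
    next
      case False
      then have pos: "\<sigma> (x, t) > 0" using \<sigma>_nonneg[of "(x, t)"] by simp
      have "(\<lambda>n. mass_density (real (Suc n)) (x, t)) \<longlonglongrightarrow> \<sigma> (x, t) powr 0 * M (x, t) powr (q - 1) * M_t (x, t)"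
        unfolding mass_density_def by (intro tendsto_mult cutoff_tendsto tendsto_const pos)
      then show ?thesis using pos by simp
    qed
  qed (auto intro!: integrable_slice continuous_mass_density t)
  also have "integral (cbox 0 One) ?h = rate t"
    unfolding rate_def torus_integral_def
    by (rule integral_spike[OF negligible_M_t_nonzero[OF t]]) auto
  finally show ?thesis .
qed

text \<open>For the second claim the limits are taken in order: first L \<rightarrow> \<infinity>
  for fixed \<delta>, which removes C2 / (\<delta> L), then \<delta> \<rightarrow> 0.\<close>

lemma flux_limit_mono_and_rate:
  assumes t: "0 < s" "s \<le> t" "t < T"
  shows "flux_limit s \<le> flux_limit t"
    and "((\<lambda>\<theta>. rate \<theta> - (q - 1) * flux_limit \<theta>) has_integral 0) {s..t}"
proof -
  have st: "\<theta> \<in> {0<..<T}" if "\<theta> \<in> {s..t}" for \<theta> using that t by auto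
  obtain C1 C2 where C: "C1 > 0" "C2 \<ge> 0"
    "\<And>L \<delta> \<theta>. L \<ge> 1 \<Longrightarrow> 0 < \<delta> \<Longrightarrow> \<delta> \<le> 1 \<Longrightarrow> \<theta> \<in> {s..t} \<Longrightarrow>
       \<bar>mass_rate L \<theta> - (q - 1) * flux L \<theta>\<bar>
       \<le> C1 * \<delta> * torus_integral (\<lambda>x. dissipation L (x, \<theta>)) + C2 / (\<delta> * L)"
    using integral_defect_bound[OF t(1,3)] unfolding mass_rate_def flux_def by metis
  obtain C0 where C0: "\<And>L x \<theta>. L \<ge> 1 \<Longrightarrow> x \<in> cbox 0 One \<Longrightarrow> \<theta> \<in> {s..t} \<Longrightarrow>
    \<bar>flux_density L (x, \<theta>)\<bar> \<le> C0 \<and> \<bar>mass_density L (x, \<theta>)\<bar> \<le> C0"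
    using densities_bounded[OF t(1,3)] by metis
  have d: "(flux L has_real_derivative torus_integral (\<lambda>x. dissipation L (x, \<theta>))) (at \<theta>)"
    if "L > 0" "\<theta> \<in> {s..t}" for L \<theta>
    unfolding flux_def[abs_def] by (rule DERIV_flux[OF that(1) st[OF that(2)]])
  have inv: "(\<lambda>n. c / real (Suc n)) \<longlonglongrightarrow> 0" for c :: real
    using LIMSEQ_ignore_initial_segment[OF lim_const_over_n[of c], of 1] by simp
  \<comment> \<open>The linear term compensates for a possibly negative dissipation; its slope tends
    to 0 like 1 / L.\<close>
  have "flux L s + C2 / C1 / L * s \<le> flux L t + C2 / C1 / L * t" if L: "L \<ge> 1" for L
  proof (rule DERIV_nonneg_imp_nondecreasing[OF t(2)])
    fix \<theta> assume th: "s \<le> \<theta>" "\<theta> \<le> t"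
    \<comment> \<open>With \<delta> = 1 the defect bound has a nonnegative left side, which turns it
      into a lower bound on the dissipation.\<close>
    have "0 \<le> C1 * torus_integral (\<lambda>x. dissipation L (x, \<theta>)) + C2 / L"
      using C(3)[OF L, of 1 \<theta>] th by (simp add: order_trans[OF abs_ge_zero])
    then have "0 \<le> torus_integral (\<lambda>x. dissipation L (x, \<theta>)) + C2 / C1 / L"
      using C(1) L by (simp add: field_simps)
    moreover have "((\<lambda>\<theta>. flux L \<theta> + C2 / C1 / L * \<theta>) has_real_derivative
        torus_integral (\<lambda>x. dissipation L (x, \<theta>)) + C2 / C1 / L) (at \<theta>)"
      using L th C(1) by (auto intro!: derivative_eq_intros d)
    ultimately show "\<exists>y. ((\<lambda>\<theta>. flux L \<theta> + C2 / C1 / L * \<theta>) has_real_derivative y) (at \<theta>) \<and> 0 \<le> y" by blast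
  qed
  from this[of "real (Suc n)" for n]
  have le: "flux (real (Suc n)) s + C2 / C1 / real (Suc n) * s \<le> flux (real (Suc n)) t + C2 / C1 / real (Suc n) * t" for n by simp
  have lim: "(\<lambda>n. flux (real (Suc n)) \<theta> + C2 / C1 / real (Suc n) * \<theta>) \<longlonglongrightarrow> flux_limit \<theta> + 0 * \<theta>" if "\<theta> \<in> {s..t}" for \<theta>
    by (intro tendsto_add tendsto_mult flux_tendsto st that inv tendsto_const)
  have "flux_limit s + 0 * s \<le> flux_limit t + 0 * t"
    by (rule LIMSEQ_le[OF lim lim]) (use le t in auto)
  then show "flux_limit s \<le> flux_limit t" by simp

  let ?h = "\<lambda>L \<theta>. mass_rate L \<theta> - (q - 1) * flux L \<theta>" and ?g = "\<lambda>\<theta>. rate \<theta> - (q - 1) * flux_limit \<theta>"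
  have int: "?h L integrable_on {s..t}" if L: "L \<ge> 1" for L
  proof (rule integrable_continuous_real)
    have "continuous_on {0<..<T} (?h L)"
      unfolding mass_rate_def flux_def
      by (intro continuous_intros continuous_torus_integral continuous_mass_density continuous_flux_density) (use L in auto)
    then show "continuous_on {s..t} (?h L)" by (rule continuous_on_subset) (use st in auto)
  qed
  have bound: "norm (?h (real (Suc n)) \<theta>) \<le> C0 + \<bar>q - 1\<bar> * C0" if th: "\<theta> \<in> {s..t}" for n \<theta>
  proof -
    have "\<bar>mass_rate (real (Suc n)) \<theta>\<bar> \<le> C0" "\<bar>flux (real (Suc n)) \<theta>\<bar> \<le> C0"
      unfolding mass_rate_def flux_def using C0[OF _ _ th]
      by (auto intro!: integral_bounded_cube continuous_mass_density continuous_flux_density st th)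
    then have "\<bar>?h (real (Suc n)) \<theta>\<bar> \<le> C0 + \<bar>q - 1\<bar> * C0"
      by (intro order_trans[OF abs_triangle_ineq4] add_mono) (auto simp: abs_mult intro: mult_left_mono)
    then show ?thesis by simp
  qed
  have lim: "(\<lambda>n. ?h (real (Suc n)) \<theta>) \<longlonglongrightarrow> ?g \<theta>" if "\<theta> \<in> {s..t}" for \<theta>
    by (intro tendsto_diff tendsto_mult tendsto_const mass_rate_tendsto flux_tendsto st that)
  note dc = dominated_convergence[of "\<lambda>n. ?h (real (Suc n))" "{s..t}" "\<lambda>_. C0 + \<bar>q - 1\<bar> * C0" ?g,
      OF int integrable_const_ivl bound lim]
  have g_int: "?g integrable_on {s..t}" by (rule dc(1)) auto
  have g_lim: "(\<lambda>n. integral {s..t} (?h (real (Suc n)))) \<longlonglongrightarrow> integral {s..t} ?g" by (rule dc(2)) auto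
  have "\<bar>integral {s..t} (?h L)\<bar> \<le> C1 * \<delta> * (flux L t - flux L s) + C2 / \<delta> / L * (t - s)"
    if L: "L \<ge> 1" and \<delta>: "0 < \<delta>" "\<delta> \<le> 1" for L \<delta>
  proof -
    \<comment> \<open>The time integral of the dissipation is an increment of the flux, which stays
      bounded as L grows because it converges.\<close>
    have "((\<lambda>\<theta>. torus_integral (\<lambda>x. dissipation L (x, \<theta>))) has_integral (flux L t - flux L s)) {s..t}"
      using L t(2) by (intro fundamental_theorem_of_calculus)
        (auto simp flip: has_real_derivative_iff_has_vector_derivative intro!: DERIV_subset[OF d])
    then have "((\<lambda>\<theta>. C1 * \<delta> * torus_integral (\<lambda>x. dissipation L (x, \<theta>)) + C2 / \<delta> / L) has_integral
        (C1 * \<delta> * (flux L t - flux L s) + C2 / \<delta> / L * (t - s))) {s..t}"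
      using has_integral_const_real[of "C2 / \<delta> / L" s t] t(2)
      by (intro has_integral_add has_integral_mult_right) (simp_all add: mult.commute content_real)
    moreover have "\<bar>?h L \<theta>\<bar> \<le> C1 * \<delta> * torus_integral (\<lambda>x. dissipation L (x, \<theta>)) + C2 / \<delta> / L" if "\<theta> \<in> {s..t}" for \<theta>
      using C(3)[OF L \<delta> that] by simp
    ultimately show ?thesis
      using integral_norm_bound_integral[OF int[OF L], of "\<lambda>\<theta>. C1 * \<delta> * torus_integral (\<lambda>x. dissipation L (x, \<theta>)) + C2 / \<delta> / L"]
      by (auto simp: has_integral_iff)
  qed
  note bnd = this
  have limit_bound: "\<bar>integral {s..t} ?g\<bar> \<le> C1 * \<delta> * (flux_limit t - flux_limit s)" if \<delta>: "0 < \<delta>" "\<delta> \<le> 1" for \<delta>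
  proof (rule LIMSEQ_le[OF tendsto_rabs[OF g_lim]])
    have "(\<lambda>n. C1 * \<delta> * (flux (real (Suc n)) t - flux (real (Suc n)) s) + C2 / \<delta> / real (Suc n) * (t - s))
      \<longlonglongrightarrow> C1 * \<delta> * (flux_limit t - flux_limit s) + 0 * (t - s)"
      using t(2) by (intro tendsto_intros flux_tendsto st inv) auto
    then show "(\<lambda>n. C1 * \<delta> * (flux (real (Suc n)) t - flux (real (Suc n)) s) + C2 / \<delta> / real (Suc n) * (t - s))
      \<longlonglongrightarrow> C1 * \<delta> * (flux_limit t - flux_limit s)" by simp
    show "\<exists>N. \<forall>n\<ge>N. \<bar>integral {s..t} (?h (real (Suc n)))\<bar>
        \<le> C1 * \<delta> * (flux (real (Suc n)) t - flux (real (Suc n)) s) + C2 / \<delta> / real (Suc n) * (t - s)"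
      using bnd[OF _ \<delta>] by auto
  qed
  \<comment> \<open>Here \<delta> tends to 0 along \<open>1 / real (Suc n)\<close>, which is at most
    1.\<close>
  have "\<bar>integral {s..t} ?g\<bar> \<le> 0"
  proof (rule LIMSEQ_le_const)
    show "(\<lambda>n. C1 * (flux_limit t - flux_limit s) / real (Suc n)) \<longlonglongrightarrow> 0" by (rule inv)
    show "\<exists>N. \<forall>n\<ge>N. \<bar>integral {s..t} ?g\<bar> \<le> C1 * (flux_limit t - flux_limit s) / real (Suc n)"
      using limit_bound[of "1 / real (Suc n)" for n] by simp
  qed
  then show "(?g has_integral 0) {s..t}"
    using g_int by (simp add: has_integral_iff)
qed

section \<open>Convexity of the integral of m^q\<close>

lemma continuous_mass_power: "continuous_on {0..T} (\<lambda>t. torus_integral (\<lambda>x. m x t powr q))"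
proof -
  have "continuous_on (UNIV \<times> {0..T}) (\<lambda>(x, t). m x t)"
    using m_smooth unfolding smooth_torus_time_def by (auto intro: smooth_on_continuous)
  then have "continuous_on ({0..T} \<times> cbox 0 One) (\<lambda>z. (\<lambda>(x, t). m x t) (snd z, fst z))"
    by (rule continuous_on_compose2) (auto intro!: continuous_intros)
  then have "continuous_on ({0..T} \<times> cbox 0 One) (\<lambda>z. m (snd z) (fst z) powr q)"
    using m_pos[THEN less_imp_neq, THEN not_sym]
    by (intro continuous_on_powr continuous_on_const) auto
  then show ?thesis
    unfolding torus_integral_def by (intro integral_continuous_on_param) (simp add: split_beta)
qed

lemma DERIV_mass_power:
  assumes t: "t \<in> {0<..<T}"
  shows "((\<lambda>t. torus_integral (\<lambda>x. m x t powr q)) has_real_derivative q * rate t) (at t)"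
proof -
  have "has_pd (\<lambda>z. M z powr q) dt (q * (M z powr (q - 1) * M_t z)) z" if "z \<in> S" for z
    by (rule has_pd_eq[OF has_pd_powr[OF has_pd_named(5)[OF that] M_pos[OF that]]]) simp
  from DERIV_torus_integral[OF this continuous_M_powr _ t]
  have "((\<lambda>t. torus_integral (\<lambda>x. M (x, t) powr q)) has_real_derivative
      torus_integral (\<lambda>x. q * (M (x, t) powr (q - 1) * M_t (x, t)))) (at t)"
    by (simp add: continuous_all)
  then show ?thesis by (simp add: M_def rate_def torus_integral_def)
qed

text \<open>Increments of the function are integrals of c = q (q - 1) I, which is nondecreasing as q
  \<ge> 1. Convexity is derived from supporting lines rather than from a second derivative: the
  integral of c is compared with its endpoint values.\<close>

lemma convex_mass_power:
  assumes q: "q \<ge> 1"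
  shows "convex_on {0..T} (\<lambda>t. torus_integral (\<lambda>x. m x t powr q))" (is "convex_on _ ?\<phi>")
proof (rule convex_on_Icc_of_subgradients[OF continuous_mass_power T_pos])
  define c where "c s = q * ((q - 1) * flux_limit s)" for s
  have incr: "c s * (t - s) \<le> ?\<phi> t - ?\<phi> s" "?\<phi> t - ?\<phi> s \<le> c t * (t - s)"
    if st: "0 < s" "s \<le> t" "t < T" for s t
  proof -
    have "((\<lambda>\<theta>. q * rate \<theta>) has_integral (?\<phi> t - ?\<phi> s)) {s..t}"
      using st by (intro fundamental_theorem_of_calculus)
        (auto simp flip: has_real_derivative_iff_has_vector_derivative intro!: DERIV_subset[OF DERIV_mass_power])
    \<comment> \<open>\<open>rate\<close> is replaced by \<open>(q - 1) * flux_limit\<close> under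
      the integral; the two are related only through their integrals.\<close>
    from has_integral_diff[OF this has_integral_mult_right[OF flux_limit_mono_and_rate(2)[OF st], of q]]
    have int: "(c has_integral (?\<phi> t - ?\<phi> s)) {s..t}"
      by (simp add: c_def[abs_def] algebra_simps)
    have mono: "c a \<le> c e" if "s \<le> a" "a \<le> e" "e \<le> t" for a e
      unfolding c_def using q st that flux_limit_mono_and_rate(1)[of a e] by (intro mult_left_mono) auto
    have k: "((\<lambda>_. k) has_integral k * (t - s)) {s..t}" for k :: real
      using has_integral_const_real[of k s t] st by (simp add: mult.commute content_real)
    show "c s * (t - s) \<le> ?\<phi> t - ?\<phi> s" by (rule has_integral_le[OF k int]) (use mono in auto)
    show "?\<phi> t - ?\<phi> s \<le> c t * (t - s)" by (rule has_integral_le[OF int k]) (use mono in auto)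
  qed
  fix s t assume "s \<in> {0<..<T}" "t \<in> {0<..<T}"
  \<comment> \<open>For \<open>t < s\<close> the upper estimate with the two times exchanged gives
    the same supporting line.\<close>
  then show "?\<phi> s + c s * (t - s) \<le> ?\<phi> t"
    using incr(1)[of s t] incr(2)[of t s] by (cases "s \<le> t") (auto simp: algebra_simps)
qed

end

theorem theorem4p1:
  fixes T \<alpha> \<beta> q :: real
    and g :: "real \<Rightarrow> real"
    and u m :: "real^'n \<Rightarrow> real \<Rightarrow> real"
  assumes "T > 0" and "\<alpha> > 0" and "\<beta> > 1" and "q \<ge> 1"
    and "smooth_on {0<..} g" and "mono_on {0<..} g"
    and "smooth_torus_time T u" and "smooth_torus_time T m"
    and "\<And>x t. t \<in> {0..T} \<Longrightarrow> m x t > 0"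
    and "solves_congestion_mfg T \<alpha> \<beta> g u m"
    and "q + 2 * \<alpha> * (1 - \<beta>) > 0"
    and "(\<beta> \<ge> 2 \<and>
            1 - (1 - 1 / real CARD('n)) / (q + 2 * \<alpha> * (1 - \<beta>)) - \<alpha> * (\<beta> - 1) / 2 \<ge> 0) \<or>
         (1 < \<beta> \<and> \<beta> < 2 \<and>
            1 - (1 - 1 / real CARD('n)) / (q + 2 * \<alpha> * (1 - \<beta>)) - \<alpha> / 2 \<ge> 0)"
  shows "convex_on {0..T} (\<lambda>t. torus_integral (\<lambda>x. m x t powr q))"
proof -
  \<comment> \<open>\<open>\<beta> \<le> 2 * (\<beta> - 1)\<close> for
    \<open>\<beta> \<ge> 2\<close>, and \<open>\<beta> \<le> 2\<close> otherwise, so both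
    alternatives yield the threshold.\<close>
  have "\<alpha> * \<beta> / 4 \<le> 1 - (1 - 1 / real CARD('n)) / (q + 2 * \<alpha> * (1 - \<beta>))"
    using assms(12)
  proof (elim disjE conjE)
    assume *: "\<beta> \<ge> 2" "1 - (1 - 1 / real CARD('n)) / (q + 2 * \<alpha> * (1 - \<beta>)) - \<alpha> * (\<beta> - 1) / 2 \<ge> 0"
    have "\<alpha> * \<beta> \<le> \<alpha> * (2 * (\<beta> - 1))" using assms(2) *(1) by (intro mult_left_mono) auto
    then show ?thesis using *(2) by linarith
  next
    assume *: "\<beta> < 2" "1 - (1 - 1 / real CARD('n)) / (q + 2 * \<alpha> * (1 - \<beta>)) - \<alpha> / 2 \<ge> 0"
    have "\<alpha> * \<beta> \<le> \<alpha> * 2" using assms(2) *(1) by (intro mult_left_mono) auto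
    then show ?thesis using *(2) by linarith
  qed
  then interpret congestion_mfg T \<alpha> \<beta> q g u m
    using assms by unfold_locales auto
  show ?thesis by (rule convex_mass_power) fact
qed

end
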